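(* Let $\mathcal{E}$ be an exact category and let $\mathcal{A}$ be a percolating subcategory of $\mathcal{E}$. A morphism $k\colon X\to Z$ is admissible in $\mathcal{E}$ if and only if $Q(k)$ is admissible in $\mathcal{E}/\mathcal{A}$. In other words, the localization functor $Q\colon\mathcal{E}\to\mathcal{E}/\mathcal{A}$ reflects admissible morphisms.
   Context: Exact categories are in the sense of Quillen (essentially small), with conflations, inflations and deflations; subcategories are full and closed under isomorphisms. A morphism is admissible if it is a composite $m\circ p$ with $p$ a deflation and $m$ an inflation; the middle object is its image. A nonempty full subcategory $\mathcal{A}$ of $\mathcal{E}$ is percolating if: (A1) for every conflation $X\rightarrowtail Y\twoheadrightarrow Z$ in $\mathcal{E}$, $Y\in\mathcal{A}$ if and only if $X,Z\in\mathcal{A}$; (A2) every morphism $X\to A$ with $A\in\mathcal{A}$ is admissible with image in $\mathcal{A}$; (A2$^{\mathrm{op}}$) every morphism $A\to X$ with $A\in\mathcal{A}$ is admissible with image in $\mathcal{A}$. $\Sigma_{\mathcal{A}}$ denotes the set of admissible morphisms of $\mathcal{E}$ with kernel and cokernel in $\mathcal{A}$, and $\mathcal{E}/\mathcal{A}=\Sigma_{\mathcal{A}}^{-1}\mathcal{E}$ is the localization, with localization functor $Q$. It is known that $\mathcal{E}/\mathcal{A}$ is an exact category whose conflations are the sequences isomorphic in $\mathcal{E}/\mathcal{A}$ to images under $Q$ of conflations in $\mathcal{E}$; admissibility in $\mathcal{E}/\mathcal{A}$ refers to this exact structure. *)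

theory Defs
  imports "HOL-Algebra.Group"
begin

section \<open>Categories\<close>

text \<open>Composition \<open>g \<cdot>\<^bsub>C\<^esub> f\<close> is written in the usual order (first \<open>f\<close>, then \<open>g\<close>); its value matters
  only when \<open>Cod C f = Dom C g\<close>.  As objects and morphisms form sets in HOL types,
  every category here is small.\<close>

record ('o, 'm) cat =
  Obj :: "'o set"
  Arr :: "'m set"
  Dom :: "'m \<Rightarrow> 'o"
  Cod :: "'m \<Rightarrow> 'o"
  Ide :: "'o \<Rightarrow> 'm"
  Comp :: "'m \<Rightarrow> 'm \<Rightarrow> 'm" (infixl "\<cdot>\<index>" 70)

definition Hom :: "('o, 'm, 'z) cat_scheme \<Rightarrow> 'o \<Rightarrow> 'o \<Rightarrow> 'm set" where
  "Hom C X Y = {f \<in> Arr C. Dom C f = X \<and> Cod C f = Y}"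

locale category =
  fixes C :: "('o, 'm, 'z) cat_scheme" (structure)
  assumes Dom_Obj: "f \<in> Arr C \<Longrightarrow> Dom C f \<in> Obj C"
    and Cod_Obj: "f \<in> Arr C \<Longrightarrow> Cod C f \<in> Obj C"
    and Ide_Hom: "X \<in> Obj C \<Longrightarrow> Ide C X \<in> Hom C X X"
    and Comp_Hom: "f \<in> Hom C X Y \<Longrightarrow> g \<in> Hom C Y Z \<Longrightarrow> g \<cdot> f \<in> Hom C X Z"
    and Comp_Ide: "f \<in> Hom C X Y \<Longrightarrow> f \<cdot> Ide C X = f"
    and Ide_Comp: "f \<in> Hom C X Y \<Longrightarrow> Ide C Y \<cdot> f = f"
    and Comp_assoc: "f \<in> Hom C W X \<Longrightarrow> g \<in> Hom C X Y \<Longrightarrow> h \<in> Hom C Y Z \<Longrightarrow>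
      h \<cdot> (g \<cdot> f) = (h \<cdot> g) \<cdot> f"

definition inverse_pair :: "('o, 'm, 'z) cat_scheme \<Rightarrow> 'm \<Rightarrow> 'm \<Rightarrow> bool" where
  "inverse_pair C f g \<longleftrightarrow> f \<in> Arr C \<and> g \<in> Hom C (Cod C f) (Dom C f) \<and>
     g \<cdot>\<^bsub>C\<^esub> f = Ide C (Dom C f) \<and> f \<cdot>\<^bsub>C\<^esub> g = Ide C (Cod C f)"

definition is_iso :: "('o, 'm, 'z) cat_scheme \<Rightarrow> 'm \<Rightarrow> bool" where
  "is_iso C f \<longleftrightarrow> (\<exists>g. inverse_pair C f g)"

definition isomorphic :: "('o, 'm, 'z) cat_scheme \<Rightarrow> 'o \<Rightarrow> 'o \<Rightarrow> bool" where
  "isomorphic C X Y \<longleftrightarrow> (\<exists>f \<in> Hom C X Y. is_iso C f)"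

definition zero_object :: "('o, 'm, 'z) cat_scheme \<Rightarrow> 'o \<Rightarrow> bool" where
  "zero_object C N \<longleftrightarrow> N \<in> Obj C \<and>
     (\<forall>X \<in> Obj C. (\<exists>!f. f \<in> Hom C X N) \<and> (\<exists>!f. f \<in> Hom C N X))"

text \<open>\<open>is_pushout C i f i' f'\<close>: the square \<open>f' \<cdot> i = i' \<cdot> f\<close> is a pushout of the span \<open>(i, f)\<close>,
  so \<open>i'\<close> is the pushout of \<open>i\<close> along \<open>f\<close>; dually for \<open>is_pullback C p f p' f'\<close>
  and the square \<open>p \<cdot> f' = f \<cdot> p'\<close>.\<close>

definition is_pushout :: "('o, 'm, 'z) cat_scheme \<Rightarrow> 'm \<Rightarrow> 'm \<Rightarrow> 'm \<Rightarrow> 'm \<Rightarrow> bool" where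
  "is_pushout C i f i' f' \<longleftrightarrow>
     i \<in> Arr C \<and> f \<in> Arr C \<and> i' \<in> Arr C \<and> f' \<in> Arr C \<and> Dom C i = Dom C f \<and>
     Dom C f' = Cod C i \<and> Dom C i' = Cod C f \<and> Cod C f' = Cod C i' \<and>
     f' \<cdot>\<^bsub>C\<^esub> i = i' \<cdot>\<^bsub>C\<^esub> f \<and>
     (\<forall>T. \<forall>a \<in> Hom C (Cod C i) T. \<forall>b \<in> Hom C (Cod C f) T. a \<cdot>\<^bsub>C\<^esub> i = b \<cdot>\<^bsub>C\<^esub> f \<longrightarrow>
        (\<exists>!u. u \<in> Hom C (Cod C i') T \<and> u \<cdot>\<^bsub>C\<^esub> f' = a \<and> u \<cdot>\<^bsub>C\<^esub> i' = b))"

definition is_pullback :: "('o, 'm, 'z) cat_scheme \<Rightarrow> 'm \<Rightarrow> 'm \<Rightarrow> 'm \<Rightarrow> 'm \<Rightarrow> bool" where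
  "is_pullback C p f p' f' \<longleftrightarrow>
     p \<in> Arr C \<and> f \<in> Arr C \<and> p' \<in> Arr C \<and> f' \<in> Arr C \<and> Cod C p = Cod C f \<and>
     Cod C f' = Dom C p \<and> Cod C p' = Dom C f \<and> Dom C f' = Dom C p' \<and>
     p \<cdot>\<^bsub>C\<^esub> f' = f \<cdot>\<^bsub>C\<^esub> p' \<and>
     (\<forall>T. \<forall>a \<in> Hom C T (Dom C p). \<forall>b \<in> Hom C T (Dom C f). p \<cdot>\<^bsub>C\<^esub> a = f \<cdot>\<^bsub>C\<^esub> b \<longrightarrow>
        (\<exists>!u. u \<in> Hom C T (Dom C p') \<and> f' \<cdot>\<^bsub>C\<^esub> u = a \<and> p' \<cdot>\<^bsub>C\<^esub> u = b))"

locale cat_functor = C: category C + D: category D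
  for C :: "('o, 'm, 'z) cat_scheme" and D :: "('p, 'n, 'y) cat_scheme" +
  fixes Fo :: "'o \<Rightarrow> 'p" and Fa :: "'m \<Rightarrow> 'n"
  assumes F_Obj: "X \<in> Obj C \<Longrightarrow> Fo X \<in> Obj D"
    and F_Hom: "f \<in> Hom C X Y \<Longrightarrow> Fa f \<in> Hom D (Fo X) (Fo Y)"
    and F_Ide: "X \<in> Obj C \<Longrightarrow> Fa (Ide C X) = Ide D (Fo X)"
    and F_Comp: "f \<in> Hom C X Y \<Longrightarrow> g \<in> Hom C Y Z \<Longrightarrow> Fa (g \<cdot>\<^bsub>C\<^esub> f) = Fa g \<cdot>\<^bsub>D\<^esub> Fa f"


section \<open>Conflations and admissible morphisms\<close>

text \<open>A conflation \<open>X \<rightarrowtail> Y \<twoheadrightarrow> Z\<close> is given by its pair of morphisms (inflation, deflation).\<close>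

record ('o, 'm) confl_cat = "('o, 'm) cat" +
  Confl :: "('m \<times> 'm) set"

definition composable :: "('o, 'm, 'z) cat_scheme \<Rightarrow> 'm \<Rightarrow> 'm \<Rightarrow> bool" where
  "composable C f g \<longleftrightarrow> f \<in> Arr C \<and> g \<in> Arr C \<and> Cod C f = Dom C g"

definition iso_sequences ::
    "('o, 'm, 'z) cat_scheme \<Rightarrow> 'm \<Rightarrow> 'm \<Rightarrow> 'm \<Rightarrow> 'm \<Rightarrow> bool" where
  "iso_sequences C f g f' g' \<longleftrightarrow> composable C f g \<and> composable C f' g' \<and>
     (\<exists>a \<in> Hom C (Dom C f) (Dom C f'). \<exists>b \<in> Hom C (Cod C f) (Cod C f').
      \<exists>c \<in> Hom C (Cod C g) (Cod C g'). is_iso C a \<and> is_iso C b \<and> is_iso C c \<and>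
        b \<cdot>\<^bsub>C\<^esub> f = f' \<cdot>\<^bsub>C\<^esub> a \<and> c \<cdot>\<^bsub>C\<^esub> g = g' \<cdot>\<^bsub>C\<^esub> b)"

definition inflation :: "('o, 'm, 'z) confl_cat_scheme \<Rightarrow> 'm \<Rightarrow> bool" where
  "inflation E i \<longleftrightarrow> (\<exists>p. (i, p) \<in> Confl E)"

definition deflation :: "('o, 'm, 'z) confl_cat_scheme \<Rightarrow> 'm \<Rightarrow> bool" where
  "deflation E p \<longleftrightarrow> (\<exists>i. (i, p) \<in> Confl E)"

definition admissible_with_image :: "('o, 'm, 'z) confl_cat_scheme \<Rightarrow> 'm \<Rightarrow> 'o \<Rightarrow> bool" where
  "admissible_with_image E f I \<longleftrightarrow>
     (\<exists>p m. deflation E p \<and> inflation E m \<and> Cod E p = I \<and> Dom E m = I \<and> f = m \<cdot>\<^bsub>E\<^esub> p)"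

definition admissible :: "('o, 'm, 'z) confl_cat_scheme \<Rightarrow> 'm \<Rightarrow> bool" where
  "admissible E f \<longleftrightarrow> (\<exists>I. admissible_with_image E f I)"


section \<open>Exact categories\<close>

record ('o, 'm) exact_cat = "('o, 'm) confl_cat" +
  Add :: "'m \<Rightarrow> 'm \<Rightarrow> 'm"
  Zero :: "'o \<Rightarrow> 'o \<Rightarrow> 'm"

definition hom_group :: "('o, 'm, 'z) exact_cat_scheme \<Rightarrow> 'o \<Rightarrow> 'o \<Rightarrow> 'm monoid" where
  "hom_group E X Y = \<lparr>carrier = Hom E X Y, mult = Add E, one = Zero E X Y\<rparr>"

definition is_biproduct ::
    "('o, 'm, 'z) exact_cat_scheme \<Rightarrow> 'o \<Rightarrow> 'o \<Rightarrow> 'o \<Rightarrow> 'm \<Rightarrow> 'm \<Rightarrow> 'm \<Rightarrow> 'm \<Rightarrow> bool" where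
  "is_biproduct E X Y B i j p q \<longleftrightarrow>
     i \<in> Hom E X B \<and> j \<in> Hom E Y B \<and> p \<in> Hom E B X \<and> q \<in> Hom E B Y \<and>
     p \<cdot>\<^bsub>E\<^esub> i = Ide E X \<and> q \<cdot>\<^bsub>E\<^esub> j = Ide E Y \<and>
     q \<cdot>\<^bsub>E\<^esub> i = Zero E X Y \<and> p \<cdot>\<^bsub>E\<^esub> j = Zero E Y X \<and>
     Add E (i \<cdot>\<^bsub>E\<^esub> p) (j \<cdot>\<^bsub>E\<^esub> q) = Ide E B"

definition is_kernel :: "('o, 'm, 'z) exact_cat_scheme \<Rightarrow> 'm \<Rightarrow> 'm \<Rightarrow> bool" where
  "is_kernel E f k \<longleftrightarrow> composable E k f \<and> f \<cdot>\<^bsub>E\<^esub> k = Zero E (Dom E k) (Cod E f) \<and>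
     (\<forall>T. \<forall>h \<in> Hom E T (Dom E f). f \<cdot>\<^bsub>E\<^esub> h = Zero E T (Cod E f) \<longrightarrow>
        (\<exists>!u. u \<in> Hom E T (Dom E k) \<and> k \<cdot>\<^bsub>E\<^esub> u = h))"

definition is_cokernel :: "('o, 'm, 'z) exact_cat_scheme \<Rightarrow> 'm \<Rightarrow> 'm \<Rightarrow> bool" where
  "is_cokernel E f c \<longleftrightarrow> composable E f c \<and> c \<cdot>\<^bsub>E\<^esub> f = Zero E (Dom E f) (Cod E c) \<and>
     (\<forall>T. \<forall>h \<in> Hom E (Cod E f) T. h \<cdot>\<^bsub>E\<^esub> f = Zero E (Dom E f) T \<longrightarrow>
        (\<exists>!u. u \<in> Hom E (Cod E c) T \<and> u \<cdot>\<^bsub>E\<^esub> c = h))"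

locale additive_category = category E
  for E :: "('o, 'm, 'z) exact_cat_scheme" (structure) +
  assumes hom_comm_group: "X \<in> Obj E \<Longrightarrow> Y \<in> Obj E \<Longrightarrow> comm_group (hom_group E X Y)"
    and Comp_Add_left: "f \<in> Hom E X Y \<Longrightarrow> g \<in> Hom E Y Z \<Longrightarrow> h \<in> Hom E Y Z \<Longrightarrow>
      Add E g h \<cdot> f = Add E (g \<cdot> f) (h \<cdot> f)"
    and Comp_Add_right: "f \<in> Hom E X Y \<Longrightarrow> g \<in> Hom E X Y \<Longrightarrow> h \<in> Hom E Y Z \<Longrightarrow>
      h \<cdot> Add E f g = Add E (h \<cdot> f) (h \<cdot> g)"
    and ex_zero_object: "\<exists>N. zero_object E N"
    and ex_biproduct: "X \<in> Obj E \<Longrightarrow> Y \<in> Obj E \<Longrightarrow> \<exists>B i j p q. is_biproduct E X Y B i j p q"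

text \<open>Quillen's exact categories, in the axiomatization of Keller and Buehler, which omits the
  redundant ``obscure axiom''.\<close>

locale exact_category = additive_category E
  for E :: "('o, 'm, 'z) exact_cat_scheme" (structure) +
  assumes Confl_kernel_cokernel: "(i, p) \<in> Confl E \<Longrightarrow> is_kernel E p i \<and> is_cokernel E i p"
    and Confl_iso: "(i, p) \<in> Confl E \<Longrightarrow> iso_sequences E i p i' p' \<Longrightarrow> (i', p') \<in> Confl E"
    and inflation_Ide: "X \<in> Obj E \<Longrightarrow> inflation E (Ide E X)"
    and deflation_Ide: "X \<in> Obj E \<Longrightarrow> deflation E (Ide E X)"
    and inflation_Comp: "inflation E i \<Longrightarrow> inflation E j \<Longrightarrow> Cod E i = Dom E j \<Longrightarrow>
      inflation E (j \<cdot> i)"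
    and deflation_Comp: "deflation E p \<Longrightarrow> deflation E q \<Longrightarrow> Cod E p = Dom E q \<Longrightarrow>
      deflation E (q \<cdot> p)"
    and inflation_pushout: "inflation E i \<Longrightarrow> f \<in> Arr E \<Longrightarrow> Dom E f = Dom E i \<Longrightarrow>
      \<exists>i' f'. is_pushout E i f i' f' \<and> inflation E i'"
    and deflation_pullback: "deflation E p \<Longrightarrow> f \<in> Arr E \<Longrightarrow> Cod E f = Cod E p \<Longrightarrow>
      \<exists>p' f'. is_pullback E p f p' f' \<and> deflation E p'"


section \<open>Percolating subcategories\<close>

text \<open>A full subcategory is given by its set of objects.\<close>

locale percolating_subcategory =
  fixes E :: "('o, 'm, 'z) exact_cat_scheme" (structure) and A :: "'o set"
  assumes A_Obj: "A \<subseteq> Obj E"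
    and A_nonempty: "A \<noteq> {}"
    and A_iso_closed: "X \<in> A \<Longrightarrow> isomorphic E X Y \<Longrightarrow> Y \<in> A"
    and A1: "(i, p) \<in> Confl E \<Longrightarrow> Cod E i \<in> A \<longleftrightarrow> Dom E i \<in> A \<and> Cod E p \<in> A"
    and A2: "f \<in> Arr E \<Longrightarrow> Cod E f \<in> A \<Longrightarrow> \<exists>I \<in> A. admissible_with_image E f I"
    and A2_op: "f \<in> Arr E \<Longrightarrow> Dom E f \<in> A \<Longrightarrow> \<exists>I \<in> A. admissible_with_image E f I"

definition Sigma_perc :: "('o, 'm, 'z) exact_cat_scheme \<Rightarrow> 'o set \<Rightarrow> 'm set" where
  "Sigma_perc E A = {s \<in> Arr E. admissible E s \<and>
     (\<exists>k. is_kernel E s k \<and> Dom E k \<in> A) \<and> (\<exists>c. is_cokernel E s c \<and> Cod E c \<in> A)}"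


section \<open>Localization of a category at a set of morphisms\<close>

text \<open>The construction of Gabriel and Zisman: a morphism is a class of zigzags, that is, of words in
  the morphisms of \<open>C\<close> (\<open>Fwd f\<close>) and formal inverses (\<open>Inv s\<close>) of the morphisms in \<open>S\<close>, modulo the
  smallest congruence that makes \<open>f \<mapsto> [Fwd f]\<close> a functor and \<open>[Inv s]\<close> inverse to \<open>[Fwd s]\<close>.
  Words are read from left to right in the order of traversal.  A morphism of the localization
  is stored with its domain and codomain.\<close>

datatype 'm step = Fwd 'm | Inv 'm

fun zigzag :: "('o, 'm, 'z) cat_scheme \<Rightarrow> 'm set \<Rightarrow> 'o \<Rightarrow> 'm step list \<Rightarrow> 'o \<Rightarrow> bool" where
  "zigzag C S X [] Y \<longleftrightarrow> X \<in> Obj C \<and> X = Y"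
| "zigzag C S X (Fwd f # w) Y \<longleftrightarrow> f \<in> Arr C \<and> Dom C f = X \<and> zigzag C S (Cod C f) w Y"
| "zigzag C S X (Inv s # w) Y \<longleftrightarrow> s \<in> Arr C \<and> s \<in> S \<and> Cod C s = X \<and> zigzag C S (Dom C s) w Y"

inductive zz_eq ::
    "('o, 'm, 'z) cat_scheme \<Rightarrow> 'm set \<Rightarrow> 'o \<Rightarrow> 'o \<Rightarrow> 'm step list \<Rightarrow> 'm step list \<Rightarrow> bool"
  for C S where
  refl: "zigzag C S X w Y \<Longrightarrow> zz_eq C S X Y w w"
| sym: "zz_eq C S X Y v w \<Longrightarrow> zz_eq C S X Y w v"
| trans: "zz_eq C S X Y u v \<Longrightarrow> zz_eq C S X Y v w \<Longrightarrow> zz_eq C S X Y u w"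
| append: "zz_eq C S X Y v v' \<Longrightarrow> zz_eq C S Y Z w w' \<Longrightarrow> zz_eq C S X Z (v @ w) (v' @ w')"
| ide: "X \<in> Obj C \<Longrightarrow> zz_eq C S X X [Fwd (Ide C X)] []"
| comp: "f \<in> Hom C X Y \<Longrightarrow> g \<in> Hom C Y Z \<Longrightarrow> zz_eq C S X Z [Fwd f, Fwd g] [Fwd (g \<cdot>\<^bsub>C\<^esub> f)]"
| inv_left: "s \<in> S \<Longrightarrow> s \<in> Hom C X Y \<Longrightarrow> zz_eq C S X X [Fwd s, Inv s] []"
| inv_right: "s \<in> S \<Longrightarrow> s \<in> Hom C X Y \<Longrightarrow> zz_eq C S Y Y [Inv s, Fwd s] []"

type_synonym ('o, 'm) loc_arr = "'o \<times> 'm step list set \<times> 'o"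

definition zz_class ::
    "('o, 'm, 'z) cat_scheme \<Rightarrow> 'm set \<Rightarrow> 'o \<Rightarrow> 'm step list \<Rightarrow> 'o \<Rightarrow> ('o, 'm) loc_arr" where
  "zz_class C S X w Y = (X, {v. zz_eq C S X Y w v}, Y)"

definition localization ::
    "('o, 'm, 'z) cat_scheme \<Rightarrow> 'm set \<Rightarrow> ('o, ('o, 'm) loc_arr) cat" where
  "localization C S = \<lparr>
     Obj = Obj C,
     Arr = {zz_class C S X w Y | X w Y. zigzag C S X w Y},
     Dom = (\<lambda>(X, _, _). X),
     Cod = (\<lambda>(_, _, Y). Y),
     Ide = (\<lambda>X. zz_class C S X [] X),
     Comp = (\<lambda>(_, W, Z) (X, V, Y). (X, {u. \<exists>v \<in> V. \<exists>w \<in> W. zz_eq C S X Z (v @ w) u}, Z))\<rparr>"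

definition loc_map :: "('o, 'm, 'z) cat_scheme \<Rightarrow> 'm set \<Rightarrow> 'm \<Rightarrow> ('o, 'm) loc_arr" where
  "loc_map C S f = zz_class C S (Dom C f) [Fwd f] (Cod C f)"

subsection \<open>The universal property\<close>

lemma zz_eq_zigzag:
  assumes "category C"
  shows "zz_eq C S X Y v w \<Longrightarrow> zigzag C S X v Y \<and> zigzag C S X w Y"
proof (induction rule: zz_eq.induct)
  interpret category C by fact
  have app: "zigzag C S X (v @ w) Z"
    if "zigzag C S X v Y" "zigzag C S Y w Z" for X v Y w Z
    using that by (induction C S X v Y rule: zigzag.induct) auto
  { case append then show ?case using app by blast }
  { case (ide X) then show ?case using Ide_Hom[of X] by (auto simp: Hom_def) }
  { case (comp f X Y g Z) then show ?case using Comp_Hom[of f X Y g Z] Cod_Obj Dom_Obj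
      by (auto simp: Hom_def) }
qed (use category.Dom_Obj[OF assms] category.Cod_Obj[OF assms] in \<open>auto simp: Hom_def\<close>)

lemma zigzag_Obj:
  assumes "category C" "zigzag C S X w Y"
  shows "X \<in> Obj C" "Y \<in> Obj C"
proof -
  interpret category C by fact
  have "X \<in> Obj C \<and> Y \<in> Obj C" using assms(2)
  proof (induction w arbitrary: X)
    case (Cons st w) then show ?case using Dom_Obj Cod_Obj by (cases st) auto
  qed auto
  then show "X \<in> Obj C" "Y \<in> Obj C" by auto
qed

lemma zigzag_append:
  "zigzag C S X v Y \<Longrightarrow> zigzag C S Y w Z \<Longrightarrow> zigzag C S X (v @ w) Z"
  by (induction C S X v Y rule: zigzag.induct) auto

lemma zz_class_eq_iff:
  assumes "zigzag C S X v Y" "zigzag C S X w Y"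
  shows "zz_class C S X v Y = zz_class C S X w Y \<longleftrightarrow> zz_eq C S X Y v w"
  using assms by (auto simp: zz_class_def set_eq_iff intro: zz_eq.intros)

lemma localization_Hom:
  "Hom (localization C S) X Y = {zz_class C S X w Y | w. zigzag C S X w Y}"
  by (auto simp: Hom_def localization_def zz_class_def)

lemma localization_Comp:
  assumes "zigzag C S X v Y" "zigzag C S Y w Z"
  shows "zz_class C S Y w Z \<cdot>\<^bsub>localization C S\<^esub> zz_class C S X v Y = zz_class C S X (v @ w) Z"
  using assms
  by (auto simp: localization_def zz_class_def
      intro: zz_eq.trans[OF zz_eq.append] zz_eq.refl)

lemma localization_Ide: "Ide (localization C S) X = zz_class C S X [] X"
  by (simp add: localization_def)

lemma category_localization:
  assumes "category C"
  shows "category (localization C S)"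
proof
  fix f X Y assume f: "f \<in> Hom (localization C S) X Y"
  then obtain v where v: "f = zz_class C S X v Y" "zigzag C S X v Y"
    by (auto simp: localization_Hom)
  note XY = zigzag_Obj[OF assms v(2)]
  show "f \<cdot>\<^bsub>localization C S\<^esub> Ide (localization C S) X = f"
    using v XY localization_Comp[of C S X "[]" X v Y] by (simp add: localization_Ide)
  show "Ide (localization C S) Y \<cdot>\<^bsub>localization C S\<^esub> f = f"
    using v XY localization_Comp[of C S X v Y "[]" Y] by (simp add: localization_Ide)
next
  fix f g X Y Z assume "f \<in> Hom (localization C S) X Y" "g \<in> Hom (localization C S) Y Z"
  then show "g \<cdot>\<^bsub>localization C S\<^esub> f \<in> Hom (localization C S) X Z"
    by (auto simp: localization_Hom localization_Comp intro: zigzag_append)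
next
  fix f g h W X Y Z assume "f \<in> Hom (localization C S) W X" "g \<in> Hom (localization C S) X Y"
    "h \<in> Hom (localization C S) Y Z"
  then show "h \<cdot>\<^bsub>localization C S\<^esub> (g \<cdot>\<^bsub>localization C S\<^esub> f) =
      (h \<cdot>\<^bsub>localization C S\<^esub> g) \<cdot>\<^bsub>localization C S\<^esub> f"
    by (auto simp: localization_Hom localization_Comp zigzag_append)
qed (use zigzag_Obj[OF assms] in
  \<open>auto simp: localization_Hom localization_Ide, auto simp: localization_def zz_class_def\<close>)

lemma functor_loc_map:
  assumes "category C"
  shows "cat_functor C (localization C S) (\<lambda>X. X) (loc_map C S)"
proof -
  interpret C: category C by fact
  interpret L: category "localization C S" by (rule category_localization) fact
  have zz: "zigzag C S X [Fwd f] Y" if "f \<in> Hom C X Y" for X Y f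
    using that C.Cod_Obj by (auto simp: Hom_def)
  have lm: "loc_map C S f = zz_class C S X [Fwd f] Y" if "f \<in> Hom C X Y" for X Y f
    using that by (auto simp: Hom_def loc_map_def)
  show ?thesis
  proof
    fix X assume "X \<in> Obj C"
    then show "X \<in> Obj (localization C S)" by (simp add: localization_def)
    show "loc_map C S (Ide C X) = Ide (localization C S) X"
      using lm[OF C.Ide_Hom] zz[OF C.Ide_Hom] \<open>X \<in> Obj C\<close>
      by (auto simp: localization_Ide zz_class_eq_iff intro: zz_eq.ide)
  next
    fix f X Y assume "f \<in> Hom C X Y"
    then show "loc_map C S f \<in> Hom (localization C S) X Y"
      using lm zz[of f X Y] unfolding localization_Hom by blast
  next
    fix f X Y g Z assume fg: "f \<in> Hom C X Y" "g \<in> Hom C Y Z"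
    have "zz_eq C S X Z [Fwd f, Fwd g] [Fwd (g \<cdot>\<^bsub>C\<^esub> f)]" using fg by (rule zz_eq.comp)
    then show "loc_map C S (g \<cdot>\<^bsub>C\<^esub> f) = loc_map C S g \<cdot>\<^bsub>localization C S\<^esub> loc_map C S f"
      using fg lm[OF C.Comp_Hom[OF fg]] lm[OF fg(1)] lm[OF fg(2)] zz[OF fg(1)] zz[OF fg(2)]
        zz_eq_zigzag[OF C.category_axioms, of S X Z]
      by (metis localization_Comp zz_class_eq_iff append_Cons append_Nil)
  qed
qed

lemma loc_map_inverts:
  assumes "category C" "s \<in> S" "s \<in> Arr C"
  shows "is_iso (localization C S) (loc_map C S s)"
proof -
  interpret category C by fact
  let ?X = "Dom C s" and ?Y = "Cod C s"
  have z: "zigzag C S ?X [Fwd s] ?Y" "zigzag C S ?Y [Inv s] ?X" "zigzag C S ?X [] ?X"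
    "zigzag C S ?Y [] ?Y" "zigzag C S ?X [Fwd s, Inv s] ?X" "zigzag C S ?Y [Inv s, Fwd s] ?Y"
    using assms Dom_Obj Cod_Obj by auto
  have s: "s \<in> Hom C ?X ?Y" using assms by (simp add: Hom_def)
  have DC: "Dom (localization C S) (zz_class C S X w Y) = X"
    "Cod (localization C S) (zz_class C S X w Y) = Y" for X w Y
    by (simp_all add: localization_def zz_class_def)
  have "inverse_pair (localization C S) (loc_map C S s) (zz_class C S ?Y [Inv s] ?X)"
    unfolding inverse_pair_def loc_map_def DC localization_Hom localization_Ide
      localization_Comp[OF z(1,2)] localization_Comp[OF z(2,1)] append_Cons append_Nil
      zz_class_eq_iff[OF z(5,3)] zz_class_eq_iff[OF z(6,4)]
    using z(1,2) zz_eq.inv_left[OF assms(2) s] zz_eq.inv_right[OF assms(2) s]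
    unfolding localization_def cat.simps by blast
  then show ?thesis unfolding is_iso_def by blast
qed

fun zz_eval :: "('p, 'n, 'y) cat_scheme \<Rightarrow> ('m \<Rightarrow> 'n) \<Rightarrow> 'p \<Rightarrow> 'm step list \<Rightarrow> 'n" where
  "zz_eval D Fa X [] = Ide D X"
| "zz_eval D Fa X (Fwd f # w) = zz_eval D Fa (Cod D (Fa f)) w \<cdot>\<^bsub>D\<^esub> Fa f"
| "zz_eval D Fa X (Inv s # w) =
     zz_eval D Fa (Dom D (Fa s)) w \<cdot>\<^bsub>D\<^esub> (SOME g. inverse_pair D (Fa s) g)"

lemma localization_universal:
  fixes C :: "('o, 'm, 'z) cat_scheme"
  assumes "cat_functor C D Fo Fa" and inv: "\<And>s. s \<in> S \<Longrightarrow> s \<in> Arr C \<Longrightarrow> is_iso D (Fa s)"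
  shows "\<exists>Ga. cat_functor (localization C S) D Fo Ga \<and> (\<forall>f \<in> Arr C. Ga (loc_map C S f) = Fa f)"
proof -
  interpret cat_functor C D Fo Fa by fact
  interpret L: category "localization C S" by (rule category_localization) unfold_locales
  define iv where "iv s = (SOME g. inverse_pair D (Fa s) g)" for s
  have iv: "inverse_pair D (Fa s) (iv s)" if "s \<in> S" "s \<in> Arr C" for s
    using inv[OF that] unfolding is_iso_def iv_def by (rule someI_ex)
  have FA: "Fa f \<in> Arr D" "Dom D (Fa f) = Fo (Dom C f)" "Cod D (Fa f) = Fo (Cod C f)"
    if "f \<in> Arr C" for f
    using that F_Hom[of f "Dom C f" "Cod C f"] by (auto simp: Hom_def)
  have ivH: "iv s \<in> Hom D (Fo (Cod C s)) (Fo (Dom C s))" if "s \<in> S" "s \<in> Arr C" for s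
    using iv[OF that] FA[OF that(2)] by (simp add: inverse_pair_def)
  define ev where "ev X w = zz_eval D Fa (Fo X) w" for X w
  have ev_simps: "ev X [] = Ide D (Fo X)"
    "f \<in> Arr C \<Longrightarrow> ev X (Fwd f # w) = ev (Cod C f) w \<cdot>\<^bsub>D\<^esub> Fa f"
    "f \<in> Arr C \<Longrightarrow> ev X (Inv f # w) = ev (Dom C f) w \<cdot>\<^bsub>D\<^esub> iv f" for X f w
    by (simp_all add: ev_def FA iv_def)
  have evH: "ev X w \<in> Hom D (Fo X) (Fo Y)" if "zigzag C S X w Y" for X w Y
    using that
  proof (induction w arbitrary: X)
    case Nil then show ?case by (auto simp: ev_simps intro: D.Ide_Hom F_Obj)
  next
    case (Cons st w)
    show ?case
    proof (cases st)
      case (Fwd f)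
      with Cons.prems have f: "f \<in> Arr C" "Dom C f = X" "zigzag C S (Cod C f) w Y" by auto
      have "Fa f \<in> Hom D (Fo X) (Fo (Cod C f))" using f F_Hom by (auto simp: Hom_def[of C])
      from D.Comp_Hom[OF this Cons.IH[OF f(3)]] f Fwd show ?thesis by (simp add: ev_simps)
    next
      case (Inv f)
      with Cons.prems have f: "f \<in> Arr C" "f \<in> S" "Cod C f = X" "zigzag C S (Dom C f) w Y" by auto
      from D.Comp_Hom[OF ivH[OF f(2,1)] Cons.IH[OF f(4)]] f Inv show ?thesis by (simp add: ev_simps)
    qed
  qed
  have ev_app: "ev X (v @ w) = ev Y w \<cdot>\<^bsub>D\<^esub> ev X v"
    if "zigzag C S X v Y" "zigzag C S Y w Z" for X v Y w Z
    using that(1)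
  proof (induction v arbitrary: X)
    case Nil then show ?case using evH[OF that(2)] D.Comp_Ide by (auto simp: ev_simps)
  next
    case (Cons st v)
    show ?case
    proof (cases st)
      case (Fwd f)
      with Cons have f: "f \<in> Arr C" "Dom C f = X" "zigzag C S (Cod C f) v Y" by auto
      have "Fa f \<in> Hom D (Fo X) (Fo (Cod C f))" using f F_Hom by (auto simp: Hom_def[of C])
      from D.Comp_assoc[OF this evH[OF f(3)] evH[OF that(2)]] Cons.IH[OF f(3)] f Fwd
      show ?thesis by (simp add: ev_simps)
    next
      case (Inv f)
      with Cons have f: "f \<in> Arr C" "f \<in> S" "Cod C f = X" "zigzag C S (Dom C f) v Y" by auto
      have "iv f \<in> Hom D (Fo X) (Fo (Dom C f))" using f ivH by auto
      from D.Comp_assoc[OF this evH[OF f(4)] evH[OF that(2)]] Cons.IH[OF f(4)] f Inv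
      show ?thesis by (simp add: ev_simps)
    qed
  qed
  have ev_Fwd: "ev X [Fwd f] = Fa f" if "f \<in> Hom C X Y" for X f Y
    using that F_Hom[OF that] D.Ide_Comp by (auto simp: Hom_def[of C] ev_simps)
  have ev_eq: "ev X v = ev X w" if "zz_eq C S X Y v w" for X Y v w
    using that
  proof (induction rule: zz_eq.induct)
    case (append X Y v v' Z w w')
    then show ?case
      using zz_eq_zigzag[OF C.category_axioms append.hyps(1)]
        zz_eq_zigzag[OF C.category_axioms append.hyps(2)]
        ev_app[of X v Y w Z] ev_app[of X v' Y w' Z] by simp
  next
    case (ide X) then show ?case by (simp add: ev_Fwd[OF C.Ide_Hom] F_Ide ev_simps)
  next
    case (comp f X Y g Z)
    then show ?case using ev_Fwd[OF C.Comp_Hom[OF comp]] ev_Fwd[OF comp(2)] F_Comp[OF comp]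
      by (auto simp: Hom_def[of C] ev_simps(2))
  next
    case (inv_left s X Y)
    then have s: "s \<in> Arr C" "Dom C s = X" "Cod C s = Y" by (auto simp: Hom_def)
    show ?case using ivH[OF inv_left(1) s(1)] iv[OF inv_left(1) s(1)] s D.Ide_Comp
      by (auto simp: ev_simps inverse_pair_def FA)
  next
    case (inv_right s X Y)
    then have s: "s \<in> Arr C" "Dom C s = X" "Cod C s = Y" by (auto simp: Hom_def)
    show ?case using F_Hom[OF inv_right(2)] iv[OF inv_right(1) s(1)] s D.Ide_Comp
      by (auto simp: ev_simps inverse_pair_def FA)
  qed auto
  define Ga where "Ga \<phi> = (case \<phi> of (X, W, Y :: 'o) \<Rightarrow> ev X (SOME w. w \<in> W))" for \<phi>
  have Ga: "Ga (zz_class C S X w Y) = ev X w" if "zigzag C S X w Y" for X w Y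
  proof -
    have "zz_eq C S X Y w (SOME v. zz_eq C S X Y w v)"
      by (rule someI[of _ w]) (rule zz_eq.refl[OF that])
    then show ?thesis by (simp add: Ga_def zz_class_def ev_eq[symmetric])
  qed
  have "cat_functor (localization C S) D Fo Ga"
  proof
    fix X assume "X \<in> Obj (localization C S)"
    then have X: "X \<in> Obj C" by (simp add: localization_def)
    then show "Fo X \<in> Obj D" by (rule F_Obj)
    show "Ga (Ide (localization C S) X) = Ide D (Fo X)"
      using X by (simp add: localization_Ide Ga ev_simps)
  next
    fix f X Y assume "f \<in> Hom (localization C S) X Y"
    then show "Ga f \<in> Hom D (Fo X) (Fo Y)" by (auto simp: localization_Hom Ga evH)
  next
    fix f X Y g Z
    assume "f \<in> Hom (localization C S) X Y" "g \<in> Hom (localization C S) Y Z"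
    then show "Ga (g \<cdot>\<^bsub>localization C S\<^esub> f) = Ga g \<cdot>\<^bsub>D\<^esub> Ga f"
      by (auto simp: localization_Hom localization_Comp Ga zigzag_append ev_app)
  qed
  moreover have "Ga (loc_map C S f) = Fa f" if "f \<in> Arr C" for f
  proof -
    have "f \<in> Hom C (Dom C f) (Cod C f)" using that by (simp add: Hom_def)
    then show ?thesis using that C.Cod_Obj by (simp add: loc_map_def Ga ev_Fwd)
  qed
  ultimately show ?thesis by blast
qed

lemma localization_unique:
  assumes "category C" and G: "cat_functor (localization C S) D Go Ga"
    and H: "cat_functor (localization C S) D Ho Ha"
    and obj: "\<And>X. X \<in> Obj C \<Longrightarrow> Go X = Ho X"
    and eq: "\<And>f. f \<in> Arr C \<Longrightarrow> Ga (loc_map C S f) = Ha (loc_map C S f)"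
    and \<phi>: "\<phi> \<in> Arr (localization C S)"
  shows "Ga \<phi> = Ha \<phi>"
proof -
  interpret C: category C by fact
  interpret G: cat_functor "localization C S" D Go Ga by fact
  interpret H: cat_functor "localization C S" D Ho Ha by fact
  let ?c = "zz_class C S"
  have mem: "?c X w Y \<in> Hom (localization C S) X Y" if "zigzag C S X w Y" for X w Y
    using that by (auto simp: localization_Hom)
  have split: "Ga (?c X (v @ w) Z) = Ga (?c Y w Z) \<cdot>\<^bsub>D\<^esub> Ga (?c X v Y)"
    "Ha (?c X (v @ w) Z) = Ha (?c Y w Z) \<cdot>\<^bsub>D\<^esub> Ha (?c X v Y)"
    if "zigzag C S X v Y" "zigzag C S Y w Z" for X v Y w Z
    using G.F_Comp[OF mem[OF that(1)] mem[OF that(2)]] H.F_Comp[OF mem[OF that(1)] mem[OF that(2)]]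
      localization_Comp[OF that] by simp_all
  have nil: "Ga (?c X [] X) = Ide D (Go X)" "Ha (?c X [] X) = Ide D (Go X)" if "X \<in> Obj C" for X
    using that G.F_Ide[of X] H.F_Ide[of X] obj by (auto simp: localization_def)
  have inv_agree: "Ga (?c (Cod C s) [Inv s] (Dom C s)) = Ha (?c (Cod C s) [Inv s] (Dom C s))"
    if s: "s \<in> S" "s \<in> Arr C" for s
  proof -
    let ?X = "Dom C s" and ?Y = "Cod C s"
    have X: "?X \<in> Obj C" and Y: "?Y \<in> Obj C" using s C.Dom_Obj C.Cod_Obj by auto
    have sH: "s \<in> Hom C ?X ?Y" using s by (simp add: Hom_def)
    have z: "zigzag C S ?X [Fwd s] ?Y" "zigzag C S ?Y [Inv s] ?X" using s X Y by auto
    have e: "?c ?X ([Fwd s] @ [Inv s]) ?X = ?c ?X [] ?X" "?c ?Y ([Inv s] @ [Fwd s]) ?Y = ?c ?Y [] ?Y"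
      using zz_eq.inv_left[OF s(1) sH] zz_eq.inv_right[OF s(1) sH] s X Y
      by (auto simp: zz_class_eq_iff)
    define a where "a = Ga (?c ?X [Fwd s] ?Y)"
    define b where "b = Ga (?c ?Y [Inv s] ?X)"
    define b' where "b' = Ha (?c ?Y [Inv s] ?X)"
    have aH: "a = Ha (?c ?X [Fwd s] ?Y)" using eq[OF s(2)] by (simp add: a_def loc_map_def)
    have a: "a \<in> Hom D (Go ?X) (Go ?Y)" and b: "b \<in> Hom D (Go ?Y) (Go ?X)"
      and b': "b' \<in> Hom D (Go ?Y) (Go ?X)"
      using G.F_Hom[OF mem[OF z(1)]] G.F_Hom[OF mem[OF z(2)]] H.F_Hom[OF mem[OF z(2)]] obj X Y
      by (auto simp: a_def b_def b'_def)
    have ab: "a \<cdot>\<^bsub>D\<^esub> b = Ide D (Go ?Y)"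
      using split(1)[OF z(2,1)] e(2) nil(1)[OF Y] by (simp add: a_def b_def)
    have b'a: "b' \<cdot>\<^bsub>D\<^esub> a = Ide D (Go ?X)"
      using split(2)[OF z(1,2)] e(1) nil(2)[OF X] by (simp add: aH b'_def)
    have "b = (b' \<cdot>\<^bsub>D\<^esub> a) \<cdot>\<^bsub>D\<^esub> b" using b'a G.D.Ide_Comp[OF b] by simp
    also have "\<dots> = b'" using G.D.Comp_assoc[OF b a b'] ab G.D.Comp_Ide[OF b'] by simp
    finally show ?thesis by (simp add: b_def b'_def)
  qed
  have main: "Ga (?c X w Y) = Ha (?c X w Y)" if "zigzag C S X w Y" for X w Y
    using that
  proof (induction w arbitrary: X)
    case Nil then show ?case using nil by auto
  next
    case (Cons st w)
    show ?case
    proof (cases st)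
      case (Fwd f)
      with Cons have f: "zigzag C S X [Fwd f] (Cod C f)" "zigzag C S (Cod C f) w Y"
        "f \<in> Arr C" "Dom C f = X" using C.Cod_Obj by auto
      then show ?thesis
        using split[OF f(1,2)] Cons.IH[OF f(2)] eq[OF f(3)] Fwd by (simp add: loc_map_def)
    next
      case (Inv s)
      with Cons have f: "zigzag C S X [Inv s] (Dom C s)" "zigzag C S (Dom C s) w Y"
        "s \<in> Arr C" "s \<in> S" "Cod C s = X" using C.Dom_Obj by auto
      then show ?thesis
        using split[OF f(1,2)] Cons.IH[OF f(2)] Inv inv_agree[OF f(4,3)] f(5)
        by simp
    qed
  qed
  from \<phi> obtain X w Y where "\<phi> = ?c X w Y" "zigzag C S X w Y" by (auto simp: localization_def)
  then show ?thesis using main by simp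
qed


section \<open>The quotient of an exact category by a percolating subcategory\<close>

definition quot_functor ::
    "('o, 'm, 'z) exact_cat_scheme \<Rightarrow> 'o set \<Rightarrow> 'm \<Rightarrow> ('o, 'm) loc_arr" where
  "quot_functor E A = loc_map E (Sigma_perc E A)"

text \<open>On objects the localization functor is the identity.\<close>

definition quot_cat ::
    "('o, 'm, 'z) exact_cat_scheme \<Rightarrow> 'o set \<Rightarrow> ('o, ('o, 'm) loc_arr) confl_cat" where
  "quot_cat E A = cat.extend (localization E (Sigma_perc E A)) (confl_cat.fields
     {(f, g). \<exists>(i, p) \<in> Confl E. iso_sequences (localization E (Sigma_perc E A))
        (quot_functor E A i) (quot_functor E A p) f g})"

lemma quot_cat_simps:
  "Obj (quot_cat E A) = Obj E"
  "Arr (quot_cat E A) = Arr (localization E (Sigma_perc E A))"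
  "Dom (quot_cat E A) = Dom (localization E (Sigma_perc E A))"
  "Cod (quot_cat E A) = Cod (localization E (Sigma_perc E A))"
  "Ide (quot_cat E A) = Ide (localization E (Sigma_perc E A))"
  "Comp (quot_cat E A) = Comp (localization E (Sigma_perc E A))"
  "Confl (quot_cat E A) = {(f, g). \<exists>(i, p) \<in> Confl E.
     iso_sequences (localization E (Sigma_perc E A)) (quot_functor E A i) (quot_functor E A p) f g}"
  by (simp_all add: quot_cat_def localization_def cat.defs confl_cat.defs)

end

(*
  A morphism that is inverted by Q lies in Sigma, and every morphism of the quotient is a right fraction
  f s^-1 with s in Sigma.  If Q(k) is admissible, then clearing denominators yields s in Sigma such that
  k s is a composite of an admissible morphism of E with morphisms of Sigma.  So everything rests on two
  facts: composing with a morphism of Sigma preserves admissibility, and it reflects it, that is, s f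
  admissible implies f admissible, and dually.  Both hold because morphisms from or to objects of A are
  admissible: the kernels and cokernels that obstruct admissibility are connected by such morphisms.
  The two facts are proved for admissible morphisms with kernel and cokernel in a Serre class B containing
  A.  The case B = Obj E concerns admissible morphisms, the case B = A concerns Sigma itself.
*)
theory Submission
  imports Defs
begin

section \<open>Arrows of a category\<close>

text \<open>The obstacle is that an inflation \<open>m\<close> followed by a deflation
  \<open>p\<close> need not be admissible in an exact category: the kernel of \<open>p\<close> and
  the image of \<open>m\<close> may have neither an intersection nor a sum that fits into
  conflations. If the kernel of \<open>p\<close> lies in \<open>A\<close>, its morphism to the
  cokernel of \<open>m\<close> is admissible, and the kernel and the image of that one morphism
  supply the intersection and the sum. Cancellation of a deflation is governed in the same way by a
  morphism between two kernels, the second of which lies in \<open>A\<close>. Saturation, the fact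
  that inverted morphisms lie in Sigma, enters because the conflations of the quotient are images of
  conflations only up to isomorphism. These isomorphisms are fractions, and they can be cleared only
  if their numerators lie in Sigma as well. Finally, morphisms of the quotient are classes under a
  generated congruence, so an equation between them gives no direct equation in \<open>E\<close>.
  Lifting zigzags to a common source extracts one, after precomposition with a morphism of
  Sigma.\<close>

context category
begin

lemma HomD: "f \<in> Hom C X Y \<Longrightarrow> f \<in> Arr C \<and> Dom C f = X \<and> Cod C f = Y \<and> X \<in> Obj C \<and> Y \<in> Obj C"
  using Dom_Obj Cod_Obj by (auto simp: Hom_def)

lemma Comp_simps [simp]:
  assumes "f \<in> Arr C" "g \<in> Arr C" "Cod C f = Dom C g"
  shows "g \<cdot> f \<in> Arr C" "Dom C (g \<cdot> f) = Dom C f" "Cod C (g \<cdot> f) = Cod C g"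
  using Comp_Hom[of f "Dom C f" "Cod C f" g "Cod C g"] assms by (auto simp: Hom_def)

lemma assoc_simp [simp]:
  assumes "f \<in> Arr C" "g \<in> Arr C" "h \<in> Arr C" "Cod C f = Dom C g" "Cod C g = Dom C h"
  shows "(h \<cdot> g) \<cdot> f = h \<cdot> (g \<cdot> f)"
  using Comp_assoc[of f "Dom C f" "Cod C f" g "Cod C g" h "Cod C h"] assms by (auto simp: Hom_def)

text \<open>Since \<open>assoc_simp\<close> nests composites to the right, an equation between
  \<open>g \<cdot> f\<close> and \<open>h\<close> no longer matches inside a longer composite. In
  this form, applied by \<open>[THEN reassoc]\<close>, it does.\<close>

lemma reassoc:
  assumes "g \<cdot> f = h" "f \<in> Arr C" "g \<in> Arr C" "x \<in> Arr C" "Cod C x = Dom C f" "Cod C f = Dom C g"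
  shows "g \<cdot> (f \<cdot> x) = h \<cdot> x"
  using assms by (metis assoc_simp)

lemma Ide_simps [simp]:
  assumes "X \<in> Obj C"
  shows "Ide C X \<in> Arr C" "Dom C (Ide C X) = X" "Cod C (Ide C X) = X"
  using Ide_Hom[OF assms] by (auto simp: Hom_def)

lemma Comp_Ide_simps [simp]:
  "f \<in> Arr C \<Longrightarrow> Dom C f = X \<Longrightarrow> f \<cdot> Ide C X = f"
  "f \<in> Arr C \<Longrightarrow> Cod C f = X \<Longrightarrow> Ide C X \<cdot> f = f"
  using Comp_Ide[of f] Ide_Comp[of f] by (auto simp: Hom_def)

lemma inverse_pair_sym: "inverse_pair C f g \<Longrightarrow> inverse_pair C g f"
  by (auto simp: inverse_pair_def Hom_def)

lemma is_isoE:
  assumes "is_iso C f" "f \<in> Hom C X Y"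
  obtains g where "g \<in> Hom C Y X" "g \<cdot> f = Ide C X" "f \<cdot> g = Ide C Y" "is_iso C g"
proof -
  obtain g where g: "inverse_pair C f g" using assms(1) unfolding is_iso_def by blast
  then have "is_iso C g" using inverse_pair_sym unfolding is_iso_def by blast
  then show thesis using that[of g] g assms(2) by (auto simp: inverse_pair_def Hom_def)
qed

lemma is_isoI:
  assumes "f \<in> Hom C X Y" "g \<in> Hom C Y X" "g \<cdot> f = Ide C X" "f \<cdot> g = Ide C Y"
  shows "is_iso C f"
  using assms unfolding is_iso_def inverse_pair_def by (auto simp: Hom_def)

lemma is_iso_Ide: "X \<in> Obj C \<Longrightarrow> is_iso C (Ide C X)"
  by (rule is_isoI[OF Ide_Hom Ide_Hom]) auto

lemma is_iso_Comp:
  assumes "f \<in> Hom C X Y" "g \<in> Hom C Y Z" "is_iso C f" "is_iso C g"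
  shows "is_iso C (g \<cdot> f)"
proof -
  note [simp] = assms(1,2)[THEN HomD]
  obtain f' where f': "f' \<in> Hom C Y X" "f' \<cdot> f = Ide C X" "f \<cdot> f' = Ide C Y"
    using is_isoE[OF assms(3,1)] by blast
  obtain g' where g': "g' \<in> Hom C Z Y" "g' \<cdot> g = Ide C Y" "g \<cdot> g' = Ide C Z"
    using is_isoE[OF assms(4,2)] by blast
  note [simp] = f'(1)[THEN HomD] g'(1)[THEN HomD]
  show ?thesis
    by (rule is_isoI[of _ X Z "f' \<cdot> g'"])
      (simp_all add: Hom_def f' g' f'(2,3)[THEN reassoc] g'(2,3)[THEN reassoc])
qed

lemma iso_sequences_sym:
  assumes "iso_sequences C f g f' g'"
  shows "iso_sequences C f' g' f g"
proof -
  have fg: "f \<in> Arr C" "g \<in> Arr C" "Cod C f = Dom C g" "f' \<in> Arr C" "g' \<in> Arr C" "Cod C f' = Dom C g'"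
    using assms unfolding iso_sequences_def composable_def by auto
  obtain a b c where abc: "a \<in> Hom C (Dom C f) (Dom C f')" "b \<in> Hom C (Cod C f) (Cod C f')"
    "c \<in> Hom C (Cod C g) (Cod C g')" "is_iso C a" "is_iso C b" "is_iso C c"
    "b \<cdot> f = f' \<cdot> a" "c \<cdot> g = g' \<cdot> b"
    using assms unfolding iso_sequences_def by blast
  obtain a' where a': "a' \<in> Hom C (Dom C f') (Dom C f)" "a' \<cdot> a = Ide C (Dom C f)"
      "a \<cdot> a' = Ide C (Dom C f')" "is_iso C a'"
    using is_isoE[OF abc(4,1)] by blast
  obtain b' where b': "b' \<in> Hom C (Cod C f') (Cod C f)" "b' \<cdot> b = Ide C (Cod C f)"
      "b \<cdot> b' = Ide C (Cod C f')" "is_iso C b'"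
    using is_isoE[OF abc(5,2)] by blast
  obtain c' where c': "c' \<in> Hom C (Cod C g') (Cod C g)" "c' \<cdot> c = Ide C (Cod C g)"
      "c \<cdot> c' = Ide C (Cod C g')" "is_iso C c'"
    using is_isoE[OF abc(6,3)] by blast
  note [simp] = abc(1-3)[THEN HomD] a'(1)[THEN HomD] b'(1)[THEN HomD] c'(1)[THEN HomD] fg
  have "b' \<cdot> f' = b' \<cdot> (f' \<cdot> (a \<cdot> a'))" by (simp add: a')
  also have "\<dots> = (b' \<cdot> (b \<cdot> f)) \<cdot> a'" by (simp add: abc)
  also have "\<dots> = f \<cdot> a'" by (simp add: b'(2)[THEN reassoc])
  finally have 1: "b' \<cdot> f' = f \<cdot> a'" .
  have "c' \<cdot> g' = c' \<cdot> (g' \<cdot> (b \<cdot> b'))" by (simp add: b')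
  also have "\<dots> = (c' \<cdot> (c \<cdot> g)) \<cdot> b'" by (simp add: abc)
  also have "\<dots> = g \<cdot> b'" by (simp add: c'(2)[THEN reassoc])
  finally have 2: "c' \<cdot> g' = g \<cdot> b'" .
  show ?thesis
    unfolding iso_sequences_def composable_def using 1 2 a' b' c' fg by blast
qed

lemma isomorphic_sym: "isomorphic C X Y \<Longrightarrow> isomorphic C Y X"
  unfolding isomorphic_def by (metis is_isoE)

end

lemma is_pushout_commute: "is_pushout C i f i' f' \<Longrightarrow> is_pushout C f i f' i'"
  unfolding is_pushout_def by (simp add: conj_commute)


section \<open>The opposite category\<close>

text \<open>Dual statements are obtained by interpreting a locale at \<open>op_cat E\<close>.  The interpretation sees only
  the lemmas of the context blocks that are already closed; this is why contexts are closed and reopened below.\<close>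

definition op_cat :: "('o, 'm, 'z) exact_cat_scheme \<Rightarrow> ('o, 'm, 'z) exact_cat_scheme" where
  "op_cat E = E\<lparr>Dom := Cod E, Cod := Dom E, Comp := \<lambda>g f. f \<cdot>\<^bsub>E\<^esub> g,
     Confl := (Confl E)\<inverse>, Zero := \<lambda>X Y. Zero E Y X\<rparr>"

lemma op_cat_simps [simp]:
  "Obj (op_cat E) = Obj E" "Arr (op_cat E) = Arr E" "Dom (op_cat E) = Cod E"
  "Cod (op_cat E) = Dom E" "Ide (op_cat E) = Ide E" "g \<cdot>\<^bsub>op_cat E\<^esub> f = f \<cdot>\<^bsub>E\<^esub> g"
  "Confl (op_cat E) = (Confl E)\<inverse>" "Add (op_cat E) = Add E" "Zero (op_cat E) X Y = Zero E Y X"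
  by (simp_all add: op_cat_def)

lemma Hom_op_cat [simp]: "Hom (op_cat E) X Y = Hom E Y X"
  by (auto simp: Hom_def)

lemma inflation_op_cat [simp]: "inflation (op_cat E) f = deflation E f"
  by (auto simp: inflation_def deflation_def)

lemma deflation_op_cat [simp]: "deflation (op_cat E) f = inflation E f"
  by (auto simp: inflation_def deflation_def)

lemma admissible_with_image_op_cat [simp]:
  "admissible_with_image (op_cat E) f I = admissible_with_image E f I"
  by (auto simp: admissible_with_image_def)

lemma hom_group_op_cat [simp]: "hom_group (op_cat E) X Y = hom_group E Y X"
  by (simp add: hom_group_def)

lemma is_kernel_op_cat [simp]: "is_kernel (op_cat E) f k = is_cokernel E f k"
  by (auto simp: is_kernel_def is_cokernel_def composable_def)

lemma is_cokernel_op_cat [simp]: "is_cokernel (op_cat E) f k = is_kernel E f k"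
  by (auto simp: is_kernel_def is_cokernel_def composable_def)

lemma is_pushout_op_cat [simp]: "is_pushout (op_cat E) i f i' f' = is_pullback E i f i' f'"
  by (simp add: is_pushout_def is_pullback_def)

lemma is_pullback_op_cat [simp]: "is_pullback (op_cat E) i f i' f' = is_pushout E i f i' f'"
  by (simp add: is_pushout_def is_pullback_def)

lemma is_iso_op_cat [simp]: "is_iso (op_cat E) f = is_iso E f"
  by (auto simp: is_iso_def inverse_pair_def)

lemma isomorphic_op_cat [simp]: "isomorphic (op_cat E) X Y = isomorphic E Y X"
  by (auto simp: isomorphic_def)

lemma zero_object_op_cat [simp]: "zero_object (op_cat E) N = zero_object E N"
  by (auto simp: zero_object_def)

lemma is_biproduct_op_cat [simp]:
  "is_biproduct (op_cat E) X Y B i j p q = is_biproduct E X Y B p q i j"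
  by (auto simp: is_biproduct_def)

lemma category_op_cat:
  assumes "category E"
  shows "category (op_cat E)"
proof -
  interpret category E by fact
  show ?thesis
    by unfold_locales (auto intro: Dom_Obj Cod_Obj Ide_Hom Comp_Hom Comp_Ide Ide_Comp simp: Comp_assoc)
qed

text \<open>The comparison isomorphisms change direction in the opposite category, which is why the
  two sequences trade places; \<open>iso_sequences_sym\<close> later restores the order.\<close>

lemma iso_sequences_op_cat:
  assumes "iso_sequences (op_cat E) p i p' i'"
  shows "iso_sequences E i' p' i p"
proof -
  have c: "composable E i p" "composable E i' p'"
    using assms unfolding iso_sequences_def composable_def by auto
  obtain a b c where "a \<in> Hom E (Cod E p') (Cod E p)" "b \<in> Hom E (Dom E p') (Dom E p)"
      "c \<in> Hom E (Dom E i') (Dom E i)" "is_iso E a" "is_iso E b" "is_iso E c"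
      "p \<cdot>\<^bsub>E\<^esub> b = a \<cdot>\<^bsub>E\<^esub> p'" "i \<cdot>\<^bsub>E\<^esub> c = b \<cdot>\<^bsub>E\<^esub> i'"
    using assms unfolding iso_sequences_def by auto
  with c show ?thesis
    unfolding iso_sequences_def composable_def
    by (intro conjI bexI[of _ c] bexI[of _ b] bexI[of _ a]) auto
qed

lemma exact_category_op_cat:
  assumes "exact_category E"
  shows "exact_category (op_cat E)"
proof -
  interpret exact_category E by fact
  interpret op: category "op_cat E" by (rule category_op_cat) unfold_locales
  show ?thesis
  proof (intro exact_category.intro additive_category.intro exact_category_axioms.intro
      additive_category_axioms.intro category_op_cat)
    show "category E" by unfold_locales
  next
    fix i p i' p' assume "(i, p) \<in> Confl (op_cat E)" "iso_sequences (op_cat E) i p i' p'"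
    then show "(i', p') \<in> Confl (op_cat E)"
      using Confl_iso[of p i p' i'] iso_sequences_op_cat iso_sequences_sym by force
  next
    fix X Y assume "X \<in> Obj (op_cat E)" "Y \<in> Obj (op_cat E)"
    then show "\<exists>B i j p q. is_biproduct (op_cat E) X Y B i j p q"
      using ex_biproduct[of X Y] by simp blast
  next
    fix i f assume "inflation (op_cat E) i" "f \<in> Arr (op_cat E)" "Dom (op_cat E) f = Dom (op_cat E) i"
    then show "\<exists>i' f'. is_pushout (op_cat E) i f i' f' \<and> inflation (op_cat E) i'"
      using deflation_pullback[of i f] by simp
  next
    fix p f assume "deflation (op_cat E) p" "f \<in> Arr (op_cat E)" "Cod (op_cat E) f = Cod (op_cat E) p"
    then show "\<exists>p' f'. is_pullback (op_cat E) p f p' f' \<and> deflation (op_cat E) p'"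
      using inflation_pushout[of p f] by simp
  qed (simp_all add: hom_comm_group Comp_Add_left Comp_Add_right ex_zero_object
      inflation_Ide deflation_Ide inflation_Comp deflation_Comp Confl_kernel_cokernel)
qed

lemma percolating_op_cat:
  assumes "exact_category E" "percolating_subcategory E A"
  shows "percolating_subcategory (op_cat E) A"
proof -
  interpret exact_category E by fact
  interpret percolating_subcategory E A by fact
  show ?thesis
  proof
    fix X Y assume "X \<in> A" "isomorphic (op_cat E) X Y"
    then show "Y \<in> A" using A_iso_closed[of X Y] isomorphic_sym[of Y X] by simp
  next
    fix i p assume "(i, p) \<in> Confl (op_cat E)"
    then show "(Cod (op_cat E) i \<in> A) = (Dom (op_cat E) i \<in> A \<and> Cod (op_cat E) p \<in> A)"
      using A1[of p i] Confl_kernel_cokernel[of p i] by (auto simp: is_kernel_def composable_def)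
  qed (use A_Obj A_nonempty A2 A2_op in auto)
qed


section \<open>Subtraction of morphisms\<close>

text \<open>An inverse makes sense only inside one Hom group, which is selected here by the domain
  and codomain of \<open>f\<close>.\<close>

definition hom_diff :: "('o, 'm, 'z) exact_cat_scheme \<Rightarrow> 'm \<Rightarrow> 'm \<Rightarrow> 'm" where
  "hom_diff E f g = Add E f (inv\<^bsub>hom_group E (Dom E f) (Cod E f)\<^esub> g)"

context additive_category
begin

lemma Zero_Hom: "X \<in> Obj E \<Longrightarrow> Y \<in> Obj E \<Longrightarrow> Zero E X Y \<in> Hom E X Y"
  using comm_group.axioms(2)[OF hom_comm_group, THEN group.is_monoid, THEN monoid.one_closed]
  by (simp add: hom_group_def)

lemma Zero_simps [simp]:
  assumes "X \<in> Obj E" "Y \<in> Obj E"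
  shows "Zero E X Y \<in> Arr E" "Dom E (Zero E X Y) = X" "Cod E (Zero E X Y) = Y"
  using Zero_Hom[OF assms] by (auto simp: Hom_def)

lemma Comp_left_hom:
  assumes "h \<in> Hom E Y Z" "X \<in> Obj E"
  shows "group_hom (hom_group E X Y) (hom_group E X Z) (\<lambda>f. h \<cdot> f)"
  using assms hom_comm_group[of X Y] hom_comm_group[of X Z] HomD[OF assms(1)] Comp_Add_right Comp_Hom
  by (intro group_hom.intro group_hom_axioms.intro homI comm_group.axioms(2))
     (auto simp: hom_group_def)

lemma Comp_right_hom:
  assumes "h \<in> Hom E X Y" "Z \<in> Obj E"
  shows "group_hom (hom_group E Y Z) (hom_group E X Z) (\<lambda>f. f \<cdot> h)"
  using assms hom_comm_group[of Y Z] hom_comm_group[of X Z] HomD[OF assms(1)] Comp_Add_left Comp_Hom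
  by (intro group_hom.intro group_hom_axioms.intro homI comm_group.axioms(2))
     (auto simp: hom_group_def)

lemma Comp_Zero [simp]:
  assumes "h \<in> Arr E" "Dom E h = Y" "X \<in> Obj E"
  shows "h \<cdot> Zero E X Y = Zero E X (Cod E h)"
  using group_hom.hom_one[OF Comp_left_hom[of h Y "Cod E h" X]] assms by (simp add: hom_group_def Hom_def)

lemma Zero_Comp [simp]:
  assumes "h \<in> Arr E" "Cod E h = Y" "Z \<in> Obj E"
  shows "Zero E Y Z \<cdot> h = Zero E (Dom E h) Z"
  using group_hom.hom_one[OF Comp_right_hom[of h "Dom E h" Y Z]] assms by (simp add: hom_group_def Hom_def)

context
  fixes f g X Y
  assumes f: "f \<in> Hom E X Y" and g: "g \<in> Hom E X Y"
begin

interpretation G: comm_group "hom_group E X Y"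
  using hom_comm_group HomD[OF f] by blast

private lemma fg: "f \<in> carrier (hom_group E X Y)" "g \<in> carrier (hom_group E X Y)"
  using f g by (simp_all add: hom_group_def)

private lemma diff_eq: "hom_diff E f g = f \<otimes>\<^bsub>hom_group E X Y\<^esub> inv\<^bsub>hom_group E X Y\<^esub> g"
  using f by (simp add: hom_diff_def hom_group_def Hom_def)

lemma diff_Hom: "hom_diff E f g \<in> Hom E X Y"
  using G.m_closed[OF fg(1) G.inv_closed[OF fg(2)]] unfolding diff_eq by (simp add: hom_group_def)

lemma diff_eq_Zero_iff: "hom_diff E f g = Zero E X Y \<longleftrightarrow> f = g"
proof -
  have "hom_diff E f g = \<one>\<^bsub>hom_group E X Y\<^esub> \<longleftrightarrow> f = g"
    using G.inv_solve_right'[OF G.one_closed fg] fg by (auto simp: diff_eq)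
  then show ?thesis by (simp add: hom_group_def)
qed

lemma diff_diff: "hom_diff E f (hom_diff E f g) = g"
proof -
  have "hom_diff E f (hom_diff E f g) =
      f \<otimes>\<^bsub>hom_group E X Y\<^esub> inv\<^bsub>hom_group E X Y\<^esub> (f \<otimes>\<^bsub>hom_group E X Y\<^esub> inv\<^bsub>hom_group E X Y\<^esub> g)"
    using f by (simp add: diff_eq) (simp add: hom_diff_def hom_group_def Hom_def)
  also have "\<dots> = g"
    using fg by (simp add: G.inv_mult G.m_assoc[symmetric])
  finally show ?thesis .
qed

lemma Comp_diff_left:
  assumes h: "h \<in> Hom E Y Z"
  shows "h \<cdot> hom_diff E f g = hom_diff E (h \<cdot> f) (h \<cdot> g)"
proof -
  interpret H: group_hom "hom_group E X Y" "hom_group E X Z" "\<lambda>f. h \<cdot> f"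
    using Comp_left_hom[OF h] HomD[OF f] by simp
  have "h \<cdot> hom_diff E f g = (h \<cdot> f) \<otimes>\<^bsub>hom_group E X Z\<^esub> inv\<^bsub>hom_group E X Z\<^esub> (h \<cdot> g)"
    using fg by (simp add: diff_eq)
  then show ?thesis
    using f h by (simp add: hom_diff_def hom_group_def Hom_def)
qed

lemma Comp_diff_right:
  assumes h: "h \<in> Hom E W X"
  shows "hom_diff E f g \<cdot> h = hom_diff E (f \<cdot> h) (g \<cdot> h)"
proof -
  interpret H: group_hom "hom_group E X Y" "hom_group E W Y" "\<lambda>f. f \<cdot> h"
    using Comp_right_hom[OF h] HomD[OF f] by simp
  have "hom_diff E f g \<cdot> h = (f \<cdot> h) \<otimes>\<^bsub>hom_group E W Y\<^esub> inv\<^bsub>hom_group E W Y\<^esub> (g \<cdot> h)"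
    using fg by (simp add: diff_eq)
  then show ?thesis
    using f h by (simp add: hom_diff_def hom_group_def Hom_def)
qed

end

end


section \<open>Conflations\<close>

definition conflation ::
    "('o, 'm, 'z) confl_cat_scheme \<Rightarrow> 'm \<Rightarrow> 'm \<Rightarrow> 'o \<Rightarrow> 'o \<Rightarrow> 'o \<Rightarrow> bool" where
  "conflation E i p X Y Z \<longleftrightarrow> (i, p) \<in> Confl E \<and> i \<in> Hom E X Y \<and> p \<in> Hom E Y Z"

lemma conflation_op_cat [simp]: "conflation (op_cat E) p i Z Y X = conflation E i p X Y Z"
  by (auto simp: conflation_def)

context exact_category
begin

interpretation op: exact_category "op_cat E"
  by (rule exact_category_op_cat) unfold_locales

lemma conflationD:
  assumes "conflation E i p X Y Z"
  shows "i \<in> Hom E X Y" "p \<in> Hom E Y Z" "p \<cdot> i = Zero E X Z" "(i, p) \<in> Confl E"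
proof -
  show "i \<in> Hom E X Y" "p \<in> Hom E Y Z" "(i, p) \<in> Confl E" using assms by (auto simp: conflation_def)
  with Confl_kernel_cokernel[of i p] show "p \<cdot> i = Zero E X Z"
    by (simp add: is_kernel_def Hom_def)
qed

lemma conflationI:
  assumes "(i, p) \<in> Confl E"
  shows "conflation E i p (Dom E i) (Cod E i) (Cod E p)"
  using assms Confl_kernel_cokernel[OF assms] by (auto simp: conflation_def is_kernel_def composable_def Hom_def)

lemma ex_conflation_inflation: "inflation E i \<Longrightarrow> \<exists>p Z. conflation E i p (Dom E i) (Cod E i) Z"
  using conflationI unfolding inflation_def by blast

lemma conflation_mono:
  assumes "conflation E i p X Y Z" "x \<in> Hom E T X" "y \<in> Hom E T X" "i \<cdot> x = i \<cdot> y"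
  shows "x = y"
proof -
  note [simp] = conflationD(1,2)[OF assms(1), THEN HomD] assms(2,3)[THEN HomD]
  have "p \<cdot> (i \<cdot> x) = Zero E T (Cod E p)"
    by (simp add: conflationD(3)[OF assms(1), THEN reassoc])
  moreover have "i \<cdot> x \<in> Hom E T (Dom E p)" by (simp add: Hom_def)
  ultimately have "\<exists>!u. u \<in> Hom E T (Dom E i) \<and> i \<cdot> u = i \<cdot> x"
    using Confl_kernel_cokernel[OF conflationD(4)[OF assms(1)]] unfolding is_kernel_def by blast
  then show ?thesis using assms by auto
qed

lemma conflation_ker:
  assumes "conflation E i p X Y Z" "h \<in> Hom E T Y" "p \<cdot> h = Zero E T Z"
  obtains u where "u \<in> Hom E T X" "i \<cdot> u = h"
proof -
  note [simp] = conflationD(1,2)[OF assms(1), THEN HomD]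
  have "\<exists>!u. u \<in> Hom E T (Dom E i) \<and> i \<cdot> u = h"
    using Confl_kernel_cokernel[OF conflationD(4)[OF assms(1)]] assms(2,3) unfolding is_kernel_def by auto
  then show thesis using that by auto
qed

end

section \<open>Isomorphism criteria and uniqueness of kernels\<close>

context exact_category
begin

interpretation op: exact_category "op_cat E"
  by (rule exact_category_op_cat) unfold_locales

lemmas conflation_epi = op.conflation_mono[simplified]
lemmas conflation_coker = op.conflation_ker[simplified]
lemmas ex_conflation_deflation = op.ex_conflation_inflation[simplified]

text \<open>The morphism \<open>u\<close> kills the difference of \<open>v \<cdot> u\<close> and the
  identity. In an additive category it is enough to state the monomorphism property for morphisms
  killed by \<open>u\<close>.\<close>

lemma mono_retraction_iso:
  assumes u: "u \<in> Hom E X Y" and v: "v \<in> Hom E Y X" and uv: "u \<cdot> v = Ide E Y"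
    and mono: "\<And>T x. x \<in> Hom E T X \<Longrightarrow> u \<cdot> x = Zero E T Y \<Longrightarrow> x = Zero E T X"
  shows "is_iso E u"
proof -
  note [simp] = u[THEN HomD] v[THEN HomD]
  have vu: "v \<cdot> u \<in> Hom E X X" by (simp add: Hom_def)
  have "u \<cdot> hom_diff E (v \<cdot> u) (Ide E X) = hom_diff E (u \<cdot> (v \<cdot> u)) (u \<cdot> Ide E X)"
    by (rule Comp_diff_left[OF vu Ide_Hom u]) simp
  also have "\<dots> = Zero E X Y"
    using diff_eq_Zero_iff[OF u u] by (simp add: uv[THEN reassoc])
  finally have "hom_diff E (v \<cdot> u) (Ide E X) = Zero E X X"
    by (intro mono diff_Hom[OF vu Ide_Hom]) auto
  then have "v \<cdot> u = Ide E X" using diff_eq_Zero_iff[OF vu Ide_Hom] by simp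
  then show ?thesis using is_isoI u v uv by blast
qed

text \<open>The kernel of \<open>e\<close> is killed by \<open>x\<close>, so \<open>x\<close> descends to a section of \<open>u\<close>.\<close>

lemma mono_deflation_iso:
  assumes e: "conflation E i e K W Y" and u: "u \<in> Hom E X Y" and x: "x \<in> Hom E W X" "u \<cdot> x = e"
    and mono: "\<And>T x. x \<in> Hom E T X \<Longrightarrow> u \<cdot> x = Zero E T Y \<Longrightarrow> x = Zero E T X"
  shows "is_iso E u"
proof -
  note [simp] = conflationD(1,2)[OF e, THEN HomD] u[THEN HomD] x(1)[THEN HomD]
  have "u \<cdot> (x \<cdot> i) = Zero E K Y"
    using conflationD(3)[OF e] x(2)[THEN reassoc] by simp
  then have "x \<cdot> i = Zero E K X" by (intro mono) (auto simp: Hom_def)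
  then obtain v where v: "v \<in> Hom E Y X" "v \<cdot> e = x"
    using conflation_coker[OF e x(1)] by blast
  note [simp] = v(1)[THEN HomD]
  have "u \<cdot> v = Ide E Y"
    by (rule conflation_epi[OF e Comp_Hom[OF v(1) u] Ide_Hom]) (auto simp: v x)
  then show ?thesis by (rule mono_retraction_iso[OF u v(1) _ mono])
qed

lemma conflation_isoI:
  assumes "conflation E i p X Y Z" "i' \<in> Hom E X' Y'" "p' \<in> Hom E Y' Z'"
    and "a \<in> Hom E X X'" "b \<in> Hom E Y Y'" "c \<in> Hom E Z Z'" "is_iso E a" "is_iso E b" "is_iso E c"
    and "b \<cdot> i = i' \<cdot> a" "c \<cdot> p = p' \<cdot> b"
  shows "conflation E i' p' X' Y' Z'"
proof -
  note [simp] = assms(2-6)[THEN HomD] conflationD(1,2)[OF assms(1), THEN HomD]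
  have "iso_sequences E i p i' p'"
    unfolding iso_sequences_def composable_def using assms by auto
  then show ?thesis
    using Confl_iso[OF conflationD(4)[OF assms(1)]] assms by (simp add: conflation_def)
qed

text \<open>Two kernels of \<open>p\<close> factor through each other, and conflations are closed
  under isomorphism; so any kernel of a deflation completes it to a conflation.\<close>

lemma conflation_kernel_unique:
  assumes c: "conflation E i p X Y Z" and i': "i' \<in> Hom E X' Y" "p \<cdot> i' = Zero E X' Z"
    and ker: "\<And>T h. h \<in> Hom E T Y \<Longrightarrow> p \<cdot> h = Zero E T Z \<Longrightarrow> \<exists>u \<in> Hom E T X'. i' \<cdot> u = h"
    and mono: "\<And>T x y. x \<in> Hom E T X' \<Longrightarrow> y \<in> Hom E T X' \<Longrightarrow> i' \<cdot> x = i' \<cdot> y \<Longrightarrow> x = y"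
  shows "conflation E i' p X' Y Z"
proof -
  note [simp] = conflationD(1,2)[OF c, THEN HomD] i'(1)[THEN HomD]
  obtain a where a: "a \<in> Hom E X X'" "i' \<cdot> a = i"
    using ker[OF conflationD(1)[OF c] conflationD(3)[OF c]] by blast
  obtain b where b: "b \<in> Hom E X' X" "i \<cdot> b = i'"
    using conflation_ker[OF c i'] by blast
  note [simp] = a(1)[THEN HomD] b(1)[THEN HomD]
  have "b \<cdot> a = Ide E X"
    by (rule conflation_mono[OF c Comp_Hom[OF a(1) b(1)] Ide_Hom]) (simp_all add: a b b(2)[THEN reassoc])
  moreover have "a \<cdot> b = Ide E X'"
    by (rule mono[OF Comp_Hom[OF b(1) a(1)] Ide_Hom]) (simp_all add: a b a(2)[THEN reassoc])
  ultimately have "is_iso E a" using is_isoI a(1) b(1) by blast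
  then show ?thesis
    using conflation_isoI[OF c i'(1) conflationD(2)[OF c] a(1) Ide_Hom Ide_Hom] is_iso_Ide
    by (simp add: a)
qed

end

context exact_category
begin

interpretation op: exact_category "op_cat E"
  by (rule exact_category_op_cat) unfold_locales

lemmas conflation_cokernel_unique = op.conflation_kernel_unique[simplified]

section \<open>Pushouts and pullbacks of conflations\<close>

lemma is_pushoutD:
  assumes "is_pushout E i f i' f'" "i \<in> Hom E X Y" "f \<in> Hom E X W"
  shows "\<exists>P. i' \<in> Hom E W P \<and> f' \<in> Hom E Y P" "f' \<cdot> i = i' \<cdot> f"
  using assms unfolding is_pushout_def by (auto simp: Hom_def)

lemma is_pushout_ex:
  assumes "is_pushout E i f i' f'" "i \<in> Hom E X Y" "f \<in> Hom E X W" "i' \<in> Hom E W P"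
    "a \<in> Hom E Y T" "b \<in> Hom E W T" "a \<cdot> i = b \<cdot> f"
  obtains u where "u \<in> Hom E P T" "u \<cdot> f' = a" "u \<cdot> i' = b"
proof -
  have "\<exists>!u. u \<in> Hom E P T \<and> u \<cdot> f' = a \<and> u \<cdot> i' = b"
    using assms HomD[OF assms(2)] HomD[OF assms(3)] HomD[OF assms(4)] unfolding is_pushout_def by auto
  then show thesis using that by auto
qed

lemma is_pushout_unique:
  assumes "is_pushout E i f i' f'" "i' \<in> Hom E W P"
    "u \<in> Hom E P T" "v \<in> Hom E P T" "u \<cdot> f' = v \<cdot> f'" "u \<cdot> i' = v \<cdot> i'"
  shows "u = v"
proof -
  have po: "i \<in> Arr E" "f \<in> Arr E" "i' \<in> Arr E" "f' \<in> Arr E" "Dom E i = Dom E f"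
     "Dom E f' = Cod E i" "Dom E i' = Cod E f" "Cod E f' = Cod E i'" "f' \<cdot> i = i' \<cdot> f"
    and U: "\<And>T a b. a \<in> Hom E (Cod E i) T \<Longrightarrow> b \<in> Hom E (Cod E f) T \<Longrightarrow> a \<cdot> i = b \<cdot> f \<Longrightarrow>
        (\<exists>!u. u \<in> Hom E (Cod E i') T \<and> u \<cdot> f' = a \<and> u \<cdot> i' = b)"
    using assms(1) unfolding is_pushout_def by blast+
  note [simp] = assms(2-4)[THEN HomD] po
  have "\<exists>!w. w \<in> Hom E (Cod E i') T \<and> w \<cdot> f' = u \<cdot> f' \<and> w \<cdot> i' = u \<cdot> i'"
    by (rule U) (use po(5-8) in \<open>auto simp: Hom_def\<close>)
  then show ?thesis using assms HomD[OF assms(2)] by auto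
qed

lemma is_pushoutI:
  assumes "i \<in> Hom E X Y" "f \<in> Hom E X W" "i' \<in> Hom E W P" "f' \<in> Hom E Y P" "f' \<cdot> i = i' \<cdot> f"
    and ex: "\<And>T a b. a \<in> Hom E Y T \<Longrightarrow> b \<in> Hom E W T \<Longrightarrow> a \<cdot> i = b \<cdot> f \<Longrightarrow>
      \<exists>u. u \<in> Hom E P T \<and> u \<cdot> f' = a \<and> u \<cdot> i' = b"
    and unique: "\<And>T u v. u \<in> Hom E P T \<Longrightarrow> v \<in> Hom E P T \<Longrightarrow> u \<cdot> f' = v \<cdot> f' \<Longrightarrow> u \<cdot> i' = v \<cdot> i' \<Longrightarrow> u = v"
  shows "is_pushout E i f i' f'"
proof -
  note [simp] = assms(1-4)[THEN HomD]
  have "\<exists>!u. u \<in> Hom E P T \<and> u \<cdot> f' = a \<and> u \<cdot> i' = b"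
    if "a \<in> Hom E Y T" "b \<in> Hom E W T" "a \<cdot> i = b \<cdot> f" for T a b
    using ex[OF that] unique by metis
  then show ?thesis unfolding is_pushout_def using assms(5) by simp
qed

text \<open>A pushout is determined up to isomorphism, so the axiom applies to every pushout of an inflation.\<close>

lemma conflation_pushout:
  assumes c: "conflation E i p X Y Z" and f: "f \<in> Hom E X W" and po: "is_pushout E i f i' f'"
    and i': "i' \<in> Hom E W P" and f': "f' \<in> Hom E Y P"
  obtains p' where "conflation E i' p' W P Z" "p' \<cdot> f' = p"
proof -
  note i = conflationD(1)[OF c] and p = conflationD(2)[OF c]
  note [simp] = i[THEN HomD] p[THEN HomD] f[THEN HomD] i'[THEN HomD] f'[THEN HomD]
  have "inflation E i" using conflationD(4)[OF c] by (auto simp: inflation_def)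
  then obtain j g where po': "is_pushout E i f j g" "inflation E j"
    using inflation_pushout[of i f] by auto
  then obtain P' where j: "j \<in> Hom E W P'" and g: "g \<in> Hom E Y P'"
    using is_pushoutD(1)[OF po'(1) i f] by blast
  note [simp] = j[THEN HomD] g[THEN HomD]
  note sq = is_pushoutD(2)[OF po i f] is_pushoutD(2)[OF po'(1) i f]
  obtain u where u: "u \<in> Hom E P' P" "u \<cdot> g = f'" "u \<cdot> j = i'"
    using is_pushout_ex[OF po'(1) i f j f' i' sq(1)] by blast
  obtain v where v: "v \<in> Hom E P P'" "v \<cdot> f' = g" "v \<cdot> i' = j"
    using is_pushout_ex[OF po i f i' g j sq(2)] by blast
  note [simp] = u(1)[THEN HomD] v(1)[THEN HomD]
  have vu: "v \<cdot> u = Ide E P'"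
    by (rule is_pushout_unique[OF po'(1) j Comp_Hom[OF u(1) v(1)] Ide_Hom]) (simp_all add: u v)
  have uv: "u \<cdot> v = Ide E P"
    by (rule is_pushout_unique[OF po i' Comp_Hom[OF v(1) u(1)] Ide_Hom]) (simp_all add: u v)
  have "is_iso E u" using is_isoI u(1) v(1) vu uv by blast
  obtain r R where jr: "conflation E j r W P' R"
    using ex_conflation_inflation[OF po'(2)] by auto
  then have c': "conflation E i' (r \<cdot> v) W P R"
    using conflation_isoI[OF jr i' Comp_Hom[OF v(1) conflationD(2)[OF jr]] Ide_Hom u(1) Ide_Hom]
      conflationD(2)[OF jr, THEN HomD] \<open>is_iso E u\<close> is_iso_Ide
    by (simp add: u vu)
  have "p \<cdot> i = Zero E W Z \<cdot> f" using conflationD(3)[OF c] by simp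
  then obtain p' where p': "p' \<in> Hom E P Z" "p' \<cdot> f' = p" "p' \<cdot> i' = Zero E W Z"
    using is_pushout_ex[OF po i f i' p Zero_Hom] by auto
  note [simp] = p'(1)[THEN HomD]
  \<comment> \<open>So far \<open>i'\<close> has the cokernel \<open>r \<cdot> v\<close>. The
    canonical \<open>p'\<close> is a cokernel too: if \<open>h\<close> kills \<open>i'\<close>, then
    \<open>h \<cdot> f'\<close> kills \<open>i\<close> and factors through \<open>p\<close>.\<close>
  have "conflation E i' p' W P Z"
  proof (rule conflation_cokernel_unique[OF c' p'(1,3)])
    fix T h assume h: "h \<in> Hom E P T" "h \<cdot> i' = Zero E W T"
    note [simp] = h(1)[THEN HomD]
    have "(h \<cdot> f') \<cdot> i = h \<cdot> (i' \<cdot> f)" using sq(1) by simp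
    also have "\<dots> = Zero E X T" using h(2)[THEN reassoc] by simp
    finally obtain w where w: "w \<in> Hom E Z T" "w \<cdot> p = h \<cdot> f'"
      using conflation_coker[OF c Comp_Hom[OF f' h(1)]] by blast
    note [simp] = w(1)[THEN HomD]
    have "w \<cdot> p' = h"
      by (rule is_pushout_unique[OF po i' Comp_Hom[OF p'(1) w(1)] h(1)]) (simp_all add: w p' h)
    with w show "\<exists>w \<in> Hom E Z T. w \<cdot> p' = h" by blast
  next
    fix T x y assume xy: "x \<in> Hom E Z T" "y \<in> Hom E Z T" "x \<cdot> p' = y \<cdot> p'"
    note [simp] = xy(1,2)[THEN HomD]
    have "(x \<cdot> p') \<cdot> f' = (y \<cdot> p') \<cdot> f'" using xy(3) by simp
    then have "x \<cdot> p = y \<cdot> p" by (simp add: p')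
    then show "x = y" by (rule conflation_epi[OF c xy(1,2)])
  qed
  then show thesis using that p'(2) by blast
qed

lemma ex_pushout:
  assumes c: "conflation E i p X Y Z" and f: "f \<in> Hom E X W"
  obtains P i' f' p' where "is_pushout E i f i' f'" "conflation E i' p' W P Z" "f' \<in> Hom E Y P"
    "p' \<cdot> f' = p" "f' \<cdot> i = i' \<cdot> f"
proof -
  have "inflation E i" using conflationD(4)[OF c] by (auto simp: inflation_def)
  then obtain j g where po': "is_pushout E i f j g" "inflation E j"
    using inflation_pushout[of i f] f conflationD(1)[OF c] by (auto simp: Hom_def)
  then obtain P' where j: "j \<in> Hom E W P'" and g: "g \<in> Hom E Y P'"
    using is_pushoutD(1)[OF po'(1) conflationD(1)[OF c] f] by blast
  show thesis
    using conflation_pushout[OF c f po'(1) j g] that[OF po'(1) _ g] is_pushoutD(2)[OF po'(1) conflationD(1)[OF c] f]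
    by metis
qed

text \<open>With \<open>P\<close> = Y/X, \<open>R\<close> = Z/X and \<open>C\<close> = Z/Y this is
  the isomorphism of (Z/X)/(Y/X) with Z/Y. The square formed by \<open>j\<close>, \<open>p\<close>,
  \<open>j'\<close>, \<open>r\<close> is a pushout, so \<open>j'\<close> is an inflation with the
  same cokernel as \<open>j\<close>.\<close>

lemma noether:
  assumes c1: "conflation E i p X Y P" and c2: "conflation E j c Y Z C"
    and c3: "conflation E (j \<cdot> i) r X Z R"
  obtains j' c' where "conflation E j' c' P R C" "j' \<cdot> p = r \<cdot> j" "c' \<cdot> r = c"
proof -
  note H = conflationD(1,2)[OF c1] conflationD(1,2)[OF c2] conflationD(2)[OF c3]
  note [simp] = H[THEN HomD]
  have "(r \<cdot> j) \<cdot> i = Zero E X R" using conflationD(3)[OF c3] by simp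
  then obtain j' where j': "j' \<in> Hom E P R" "j' \<cdot> p = r \<cdot> j"
    using conflation_coker[OF c1 Comp_Hom[OF H(3) H(5)]] by blast
  note [simp] = j'(1)[THEN HomD]
  have po: "is_pushout E j p j' r"
  proof (rule is_pushoutI[OF H(3,2) j'(1) H(5)])
    fix T a b assume ab: "a \<in> Hom E Z T" "b \<in> Hom E P T" "a \<cdot> j = b \<cdot> p"
    note [simp] = ab(1,2)[THEN HomD]
    have "a \<cdot> (j \<cdot> i) = b \<cdot> (p \<cdot> i)" by (simp add: ab(3)[THEN reassoc])
    also have "\<dots> = Zero E X T" by (simp add: conflationD(3)[OF c1])
    finally obtain u where u: "u \<in> Hom E R T" "u \<cdot> r = a"
      using conflation_coker[OF c3 ab(1)] by blast
    note [simp] = u(1)[THEN HomD]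
    have "u \<cdot> j' = b"
      by (rule conflation_epi[OF c1 Comp_Hom[OF j'(1) u(1)] ab(2)]) (simp_all add: j' ab u(2)[THEN reassoc])
    with u show "\<exists>u. u \<in> Hom E R T \<and> u \<cdot> r = a \<and> u \<cdot> j' = b" by blast
  qed (use j'(2) conflation_epi[OF c3] in auto)
  obtain c' where "conflation E j' c' P R C" "c' \<cdot> r = c"
    using conflation_pushout[OF c2 H(2) po j'(1) H(5)] by blast
  then show thesis using that j'(2) by blast
qed

end

context exact_category
begin

interpretation op: exact_category "op_cat E"
  by (rule exact_category_op_cat) unfold_locales

lemmas ex_pullback = op.ex_pushout[simplified]
text \<open>For two composable deflations: the kernel of the composite is an extension of the kernel
  of the second by the kernel of the first.\<close>

lemmas noether_op = op.noether[simplified]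

text \<open>On the pullback \<open>W\<close> of \<open>p\<close> and \<open>p'\<close>, the
  morphisms \<open>u \<cdot> f'\<close> and \<open>q\<close> to \<open>Y\<close> agree after
  \<open>p'\<close>, so they differ by a morphism through \<open>K\<close>. Correcting
  \<open>f'\<close> by this difference makes the deflation \<open>q\<close> factor through
  \<open>u\<close>, and \<open>u\<close> is monic.\<close>

lemma five_lemma:
  assumes c: "conflation E k p K P I" and c': "conflation E k' p' K Y I"
    and u: "u \<in> Hom E P Y" "u \<cdot> k = k'" "p' \<cdot> u = p"
  shows "is_iso E u"
proof -
  note H = conflationD(1,2)[OF c] conflationD(1,2)[OF c'] u(1)
  note [simp] = H[THEN HomD]
  obtain W q f' i' where W: "conflation E i' q K W Y" "f' \<in> Hom E W P" "p \<cdot> f' = p' \<cdot> q"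
    using ex_pullback[OF c H(4)] by metis
  note q = conflationD(2)[OF W(1)]
  note [simp] = q[THEN HomD] W(2)[THEN HomD]
  have uf: "u \<cdot> f' \<in> Hom E W Y" by (simp add: Hom_def)
  have "p' \<cdot> (u \<cdot> f') = p' \<cdot> q" by (simp add: u(3)[THEN reassoc] W(3))
  then have "p' \<cdot> hom_diff E (u \<cdot> f') q = Zero E W I"
    using Comp_diff_left[OF uf q H(4)] diff_eq_Zero_iff[OF Comp_Hom[OF q H(4)] Comp_Hom[OF q H(4)]] by simp
  then obtain d where d: "d \<in> Hom E W K" "k' \<cdot> d = hom_diff E (u \<cdot> f') q"
    using conflation_ker[OF c' diff_Hom[OF uf q]] by blast
  note [simp] = d(1)[THEN HomD]
  have kd: "k \<cdot> d \<in> Hom E W P" by (simp add: Hom_def)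
  have "u \<cdot> hom_diff E f' (k \<cdot> d) = hom_diff E (u \<cdot> f') (k' \<cdot> d)"
    using Comp_diff_left[OF W(2) kd u(1)] by (simp add: u(2)[THEN reassoc])
  also have "\<dots> = q" unfolding d(2) by (rule diff_diff[OF uf q])
  finally have 1: "u \<cdot> hom_diff E f' (k \<cdot> d) = q" .
  show ?thesis
  proof (rule mono_deflation_iso[OF W(1) u(1) diff_Hom[OF W(2) kd] 1])
    fix T x assume x: "x \<in> Hom E T P" "u \<cdot> x = Zero E T Y"
    note [simp] = x(1)[THEN HomD]
    have "p \<cdot> x = p' \<cdot> (u \<cdot> x)" by (simp add: u(3)[THEN reassoc])
    also have "\<dots> = Zero E T I" by (simp add: x)
    finally obtain y where y: "y \<in> Hom E T K" "k \<cdot> y = x" using conflation_ker[OF c x(1)] by blast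
    note [simp] = y(1)[THEN HomD]
    have "k' \<cdot> y = Zero E T Y" using x y u(2)[THEN reassoc, of y] by simp
    then have "y = Zero E T K"
      using conflation_mono[OF c' y(1) Zero_Hom] by simp
    then show "x = Zero E T P" using y(2) by simp
  qed
qed

text \<open>The pushout of \<open>i\<close> along \<open>g\<close> is a conflation with the same
  ends \<open>K\<close> and \<open>I\<close> as the second row, so its comparison with
  \<open>Y\<close> is an isomorphism by \<open>five_lemma\<close>. This recognizes any morphism of
  conflations that is the identity on \<open>I\<close> as a pushout.\<close>

lemma square_pushout:
  assumes c: "conflation E i p L X I" and c': "conflation E k q K Y I"
    and f: "f \<in> Hom E X Y" "q \<cdot> f = p" and g: "g \<in> Hom E L K" "f \<cdot> i = k \<cdot> g"
  shows "is_pushout E i g k f"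
proof -
  note H = conflationD(1,2)[OF c] conflationD(1,2)[OF c'] f(1) g(1)
  note [simp] = H[THEN HomD]
  obtain P i' f' p' where P: "is_pushout E i g i' f'" "conflation E i' p' K P I" "f' \<in> Hom E X P"
    "p' \<cdot> f' = p" "f' \<cdot> i = i' \<cdot> g"
    using ex_pushout[OF c g(1)] by metis
  note P' = conflationD(1,2)[OF P(2)]
  note [simp] = P'[THEN HomD] P(3)[THEN HomD]
  obtain u where u: "u \<in> Hom E P Y" "u \<cdot> f' = f" "u \<cdot> i' = k"
    using is_pushout_ex[OF P(1) H(1) g(1) P'(1) f(1) H(3) g(2)] by blast
  note [simp] = u(1)[THEN HomD]
  have qu: "q \<cdot> u = p'"
    by (rule is_pushout_unique[OF P(1) P'(1) Comp_Hom[OF u(1) H(4)] P'(2)])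
      (simp_all add: u P f conflationD(3)[OF c'] conflationD(3)[OF P(2)])
  obtain v where v: "v \<in> Hom E Y P" "v \<cdot> u = Ide E P" "u \<cdot> v = Ide E Y"
    using is_isoE[OF five_lemma[OF P(2) c' u(1,3) qu] u(1)] by blast
  note [simp] = v(1)[THEN HomD]
  have vf: "v \<cdot> f = f'" using v(2)[THEN reassoc, of f'] u(2) by simp
  have vk: "v \<cdot> k = i'" using v(2)[THEN reassoc, of i'] u(3) by simp
  show ?thesis
  proof (rule is_pushoutI[OF H(1) g(1) H(3) f(1) g(2)])
    fix T a b assume ab: "a \<in> Hom E X T" "b \<in> Hom E K T" "a \<cdot> i = b \<cdot> g"
    obtain w where w: "w \<in> Hom E P T" "w \<cdot> f' = a" "w \<cdot> i' = b"
      using is_pushout_ex[OF P(1) H(1) g(1) P'(1) ab] by blast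
    note [simp] = w(1)[THEN HomD]
    show "\<exists>u. u \<in> Hom E Y T \<and> u \<cdot> f = a \<and> u \<cdot> k = b"
      by (rule exI[of _ "w \<cdot> v"]) (simp add: Hom_def vf vk w)
  next
    fix T x y assume xy: "x \<in> Hom E Y T" "y \<in> Hom E Y T" "x \<cdot> f = y \<cdot> f" "x \<cdot> k = y \<cdot> k"
    note [simp] = xy(1,2)[THEN HomD]
    have "x \<cdot> u = y \<cdot> u"
      by (rule is_pushout_unique[OF P(1) P'(1) Comp_Hom[OF u(1) xy(1)] Comp_Hom[OF u(1) xy(2)]])
        (simp_all add: u xy)
    then have "(x \<cdot> u) \<cdot> v = (y \<cdot> u) \<cdot> v" by simp
    then show "x = y" by (simp add: v)
  qed
qed

lemma conflation_Comp_deflation: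
  assumes "conflation E i p X Y Z" "conflation E j q V Z W"
  obtains k K where "conflation E k (q \<cdot> p) K Y W"
proof -
  note H = conflationD(2)[OF assms(1)] conflationD(2)[OF assms(2)]
  have "deflation E (q \<cdot> p)"
    using deflation_Comp[of p q] H conflationD(4)[OF assms(1)] conflationD(4)[OF assms(2)]
    by (auto simp: deflation_def Hom_def)
  then show thesis using ex_conflation_deflation[of "q \<cdot> p"] H[THEN HomD] that by auto
qed

lemma conflation_Comp_inflation:
  assumes "conflation E i p X Y Z" "conflation E j q Y V W"
  obtains c C where "conflation E (j \<cdot> i) c X V C"
proof -
  note H = conflationD(1)[OF assms(1)] conflationD(1)[OF assms(2)]
  have "inflation E (j \<cdot> i)"
    using inflation_Comp[of i j] H conflationD(4)[OF assms(1)] conflationD(4)[OF assms(2)]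
    by (auto simp: inflation_def Hom_def)
  then show thesis using ex_conflation_inflation[of "j \<cdot> i"] H[THEN HomD] that by auto
qed

end

section \<open>Admissible morphisms with kernel and cokernel in a Serre class\<close>

text \<open>Recording both conflations gives the kernel and cokernel as the objects \<open>N\<close>
  and \<open>C\<close> and makes the notion visibly self-dual.\<close>

definition admissible_mod ::
    "('o, 'm, 'z) confl_cat_scheme \<Rightarrow> 'o set \<Rightarrow> 'o \<Rightarrow> 'o \<Rightarrow> 'm \<Rightarrow> bool" where
  "admissible_mod E B X Y f \<longleftrightarrow> (\<exists>k q N I m c C. conflation E k q N X I \<and> conflation E m c I Y C \<and>
     N \<in> B \<and> C \<in> B \<and> f = m \<cdot>\<^bsub>E\<^esub> q)"

lemma admissible_modI:
  "conflation E k q N X I \<Longrightarrow> conflation E m c I Y C \<Longrightarrow> N \<in> B \<Longrightarrow> C \<in> B \<Longrightarrow>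
   f = m \<cdot>\<^bsub>E\<^esub> q \<Longrightarrow> admissible_mod E B X Y f"
  unfolding admissible_mod_def by blast

lemma admissible_modE:
  assumes "admissible_mod E B X Y f"
  obtains k q N I m c C where "conflation E k q N X I" "conflation E m c I Y C" "N \<in> B" "C \<in> B"
    "f = m \<cdot>\<^bsub>E\<^esub> q"
  using assms unfolding admissible_mod_def by blast

lemma admissible_mod_op_cat [simp]:
  "admissible_mod (op_cat E) B Y X f = admissible_mod E B X Y f"
  unfolding admissible_mod_def conflation_op_cat op_cat_simps by blast

lemma (in exact_category) admissible_with_imageE:
  assumes "admissible_with_image E f J" "f \<in> Hom E X Y"
  obtains k r K j c C where "conflation E k r K X J" "conflation E j c J Y C" "f = j \<cdot> r"
proof -
  obtain r j where J: "deflation E r" "inflation E j" "Cod E r = J" "Dom E j = J" "f = j \<cdot> r"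
    using assms(1) by (auto simp: admissible_with_image_def)
  obtain k K where k: "conflation E k r K (Dom E r) J"
    using ex_conflation_deflation[OF J(1)] J(3) by auto
  obtain c C where c: "conflation E j c J (Cod E j) C"
    using ex_conflation_inflation[OF J(2)] J(4) by auto
  have "r \<in> Arr E" "j \<in> Arr E" "Cod E r = Dom E j"
    using HomD[OF conflationD(2)[OF k]] HomD[OF conflationD(1)[OF c]] J(3,4) by auto
  then have "Dom E r = X" "Cod E j = Y" using HomD[OF assms(2)] unfolding J(5) by auto
  then show thesis using that k c J(5) by blast
qed

section \<open>Morphisms to and from objects of \<open>A\<close>\<close>

locale percolating_exact_category = exact_category E + percolating_subcategory E A
  for E :: "('o, 'm, 'z) exact_cat_scheme" (structure) and A

lemma percolating_exact_category_op_cat: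
  "percolating_exact_category E A \<Longrightarrow> percolating_exact_category (op_cat E) A"
  by (simp add: percolating_exact_category_def exact_category_op_cat percolating_op_cat)

context percolating_exact_category
begin

interpretation op: percolating_exact_category "op_cat E" A
  by (rule percolating_exact_category_op_cat) unfold_locales

text \<open>The cokernel is a quotient of \<open>Y\<close> and so lies in \<open>A\<close> by
  \<open>A1\<close>; the kernel \<open>K\<close> is unrestricted.\<close>

lemma morphism_to_A:
  assumes "f \<in> Hom E X Y" "Y \<in> A"
  obtains k r K J j c C where "conflation E k r K X J" "conflation E j c J Y C" "J \<in> A" "C \<in> A" "f = j \<cdot> r"
proof -
  obtain J where "J \<in> A" "admissible_with_image E f J"
    using A2[of f] assms by (auto simp: Hom_def)
  then obtain k r K j c C where F: "conflation E k r K X J" "conflation E j c J Y C" "f = j \<cdot> r"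
    using admissible_with_imageE assms(1) by metis
  moreover have "C \<in> A"
    using A1[OF conflationD(4)[OF F(2)]] assms(2) conflationD(1,2)[OF F(2), THEN HomD] by simp
  ultimately show thesis using that \<open>J \<in> A\<close> by blast
qed

text \<open>In an admissible factorization of \<open>f\<close> the deflation is again monic, hence
  an isomorphism, and \<open>f\<close> is isomorphic to the inflation.\<close>

lemma mono_from_A:
  assumes f: "f \<in> Hom E X Y" and X: "X \<in> A"
    and mono: "\<And>T x. x \<in> Hom E T X \<Longrightarrow> f \<cdot> x = Zero E T Y \<Longrightarrow> x = Zero E T X"
  obtains c C where "conflation E f c X Y C"
proof -
  obtain J where "admissible_with_image E f J"
    using A2_op[of f] f X by (auto simp: Hom_def)
  then obtain k r K j c C where k: "conflation E k r K X J" and c: "conflation E j c J Y C"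
    and J: "f = j \<cdot> r"
    using admissible_with_imageE f by metis
  note [simp] = conflationD(1,2)[OF k, THEN HomD] conflationD(1,2)[OF c, THEN HomD]
  have r: "r \<in> Hom E X J" by (simp add: Hom_def)
  have "is_iso E r"
  proof (rule mono_deflation_iso[OF k r Ide_Hom])
    fix T x assume x: "x \<in> Hom E T X" "r \<cdot> x = Zero E T J"
    note [simp] = x(1)[THEN HomD]
    show "x = Zero E T X" by (rule mono[OF x(1)]) (simp add: J x(2))
  qed (use HomD[OF r] in auto)
  then obtain r' where r': "r' \<in> Hom E J X" "r \<cdot> r' = Ide E J" "is_iso E r'"
    using is_isoE[OF _ r] by blast
  note [simp] = r'(1)[THEN HomD]
  have "conflation E f c X Y C"
    by (rule conflation_isoI[OF c f conflationD(2)[OF c] r'(1) Ide_Hom Ide_Hom r'(3) is_iso_Ide is_iso_Ide])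
      (use HomD[OF f] in \<open>simp_all add: J r'(2)\<close>)
  then show thesis using that by blast
qed

text \<open>Kernels of identities are zero objects and therefore all isomorphic. One of them lies in
  \<open>A\<close>, as a subobject of some member of the nonempty class.\<close>

lemma kernel_Ide_in_A:
  assumes "conflation E i (Ide E X) N X X"
  shows "N \<in> A"
proof -
  have null: "Ide E N = Zero E N N" if "conflation E i (Ide E X) N X X" for i X N
  proof -
    note [simp] = conflationD(1)[OF that, THEN HomD]
    have "i = Zero E N X" using conflationD(3)[OF that] by simp
    then have "i \<cdot> Ide E N = i \<cdot> Zero E N N" by simp
    then show ?thesis by (rule conflation_mono[OF that Ide_Hom Zero_Hom, rotated 3]) auto
  qed
  obtain X' where X': "X' \<in> A" using A_nonempty by blast
  then have "X' \<in> Obj E" using A_Obj by blast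
  then obtain i' N' where i': "conflation E i' (Ide E X') N' X' X'"
    using ex_conflation_deflation[OF deflation_Ide[of X']] by auto
  then have N': "N' \<in> A" using A1[OF conflationD(4)[OF i']] X' conflationD(1)[OF i'] by (simp add: Hom_def)
  note [simp] = conflationD(1)[OF assms, THEN HomD] conflationD(1)[OF i', THEN HomD]
  have "is_iso E (Zero E N' N)"
    by (rule is_isoI[OF Zero_Hom Zero_Hom]) (simp_all add: null[OF assms] null[OF i'])
  then have "isomorphic E N' N" unfolding isomorphic_def using Zero_Hom[of N' N] by auto
  then show ?thesis using A_iso_closed N' by blast
qed

end

text \<open>Admissibility always comes from \<open>A\<close>; the class \<open>B\<close> only keeps
  track of where kernels and cokernels lie.\<close>

locale serre_class = percolating_exact_category E A
  for E :: "('o, 'm, 'z) exact_cat_scheme" (structure) and A +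
  fixes B :: "'o set"
  assumes A_subset_B: "A \<subseteq> B"
    and B_conflation: "conflation E i p X Y Z \<Longrightarrow> Y \<in> B \<longleftrightarrow> X \<in> B \<and> Z \<in> B"

lemma serre_class_op_cat:
  assumes "serre_class E A B"
  shows "serre_class (op_cat E) A B"
proof -
  interpret serre_class E A B by fact
  interpret op: percolating_exact_category "op_cat E" A
    by (rule percolating_exact_category_op_cat) unfold_locales
  show ?thesis by unfold_locales (use A_subset_B B_conflation in auto)
qed

lemma (in percolating_exact_category) serre_class_A: "serre_class E A A"
  by unfold_locales (use A1 in \<open>auto simp: conflation_def Hom_def\<close>)

lemma (in percolating_exact_category) serre_class_Obj: "serre_class E A (Obj E)"
  by unfold_locales (use A_Obj in \<open>auto dest: conflationD(1,2)[THEN HomD]\<close>)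

context percolating_exact_category
begin

interpretation op: percolating_exact_category "op_cat E" A
  by (rule percolating_exact_category_op_cat) unfold_locales

lemmas morphism_from_A = op.morphism_to_A[simplified]
lemmas epi_to_A = op.mono_from_A[simplified]
lemmas cokernel_Ide_in_A = op.kernel_Ide_in_A[simplified]

end

section \<open>Composition and cancellation with morphisms of Sigma\<close>

context serre_class
begin

lemma admissible_mod_Hom: "admissible_mod E B X Y f \<Longrightarrow> f \<in> Hom E X Y"
  by (metis admissible_modE Comp_Hom conflationD(1,2))

lemma admissible_mod_inflation:
  assumes "conflation E m c X Y C" "C \<in> B"
  shows "admissible_mod E B X Y m"
proof -
  note [simp] = conflationD(1)[OF assms(1), THEN HomD]
  obtain i N where "conflation E i (Ide E X) N X X"
    using ex_conflation_deflation[OF deflation_Ide[of X]] by auto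
  then show ?thesis
    using admissible_modI[OF _ assms(1) _ assms(2), of i "Ide E X" N X m] kernel_Ide_in_A A_subset_B
    by auto
qed

text \<open>The kernel does not change, and by \<open>noether\<close> the new cokernel is an
  extension of \<open>C\<close> by the old one.\<close>

lemma inflation_Comp_admissible_mod:
  assumes m: "conflation E m c Y Z C" "C \<in> B" and f: "admissible_mod E B X Y f"
  shows "admissible_mod E B X Z (m \<cdot> f)"
proof -
  obtain k q N I m1 c1 C1 where F: "conflation E k q N X I" "conflation E m1 c1 I Y C1" "N \<in> B"
      "C1 \<in> B" "f = m1 \<cdot> q"
    using f by (elim admissible_modE)
  note [simp] = conflationD(1,2)[OF F(1), THEN HomD] conflationD(1,2)[OF F(2), THEN HomD]
    conflationD(1,2)[OF m(1), THEN HomD]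
  obtain r R where r: "conflation E (m \<cdot> m1) r I Z R"
    using conflation_Comp_inflation[OF F(2) m(1)] by blast
  obtain j' c' where "conflation E j' c' C1 R C"
    using noether[OF F(2) m(1) r] by blast
  then have "R \<in> B" using B_conflation F(4) m(2) by blast
  then show ?thesis
    using admissible_modI[OF F(1) r F(3)] F(5) by simp
qed

text \<open>The image of \<open>K\<close> in \<open>D\<close> cuts out a subobject \<open>Y'\<close> of \<open>Y\<close> containing both \<open>K\<close> and \<open>I\<close>;
  the image of \<open>p \<cdot> m\<close> is \<open>Y' / K\<close>.\<close>

lemma deflation_Comp_inflation:
  assumes p: "conflation E k p K Y Z" "K \<in> A" and m: "conflation E m d I Y D" "D \<in> B"
  shows "admissible_mod E B I Z (p \<cdot> m)"
proof -
  note H = conflationD(1,2)[OF p(1)] conflationD(1,2)[OF m(1)]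
  note [simp] = H[THEN HomD]
  \<comment> \<open>In terms of subobjects of \<open>Y\<close>, the objects built below are:
    \<open>K'\<close> the intersection of \<open>K\<close> and \<open>I\<close>, \<open>Y'\<close>
    their sum, \<open>J\<close> = Y'/I, and \<open>T\<close> = I/K' = Y'/K. All arise from the
    morphism \<open>d \<cdot> k\<close>, which is admissible because \<open>K\<close> lies in
    \<open>A\<close>.\<close>
  obtain J where J: "admissible_with_image E (d \<cdot> k) J"
    using A2_op[of "d \<cdot> k"] p(2) by auto
  obtain k1 r K' j c C where F: "conflation E k1 r K' K J" "conflation E j c J D C" "d \<cdot> k = j \<cdot> r"
    using admissible_with_imageE[OF J Comp_Hom[OF H(1) H(4)]] by metis
  note HF = conflationD(1,2)[OF F(1)] conflationD(1,2)[OF F(2)]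
  note [simp] = HF[THEN HomD]
  have K'A: "K' \<in> A" using serre_class.B_conflation[OF serre_class_A F(1)] p(2) by simp
  have CB: "C \<in> B" using B_conflation[OF F(2)] m(2) by simp
  obtain y Y' where y: "conflation E y (c \<cdot> d) Y' Y C"
    using conflation_Comp_deflation[OF m(1) F(2)] by blast
  obtain d' m' where d': "conflation E m' d' I Y' J" "j \<cdot> d' = d \<cdot> y" "y \<cdot> m' = m"
    using noether_op[OF F(2) m(1) y] by blast
  note HY = conflationD(1)[OF y] conflationD(1,2)[OF d'(1)]
  note [simp] = HY[THEN HomD]
  have "(c \<cdot> d) \<cdot> k = (c \<cdot> j) \<cdot> r" using F(3) by simp
  also have "\<dots> = Zero E K C" using conflationD(3)[OF F(2)] by simp
  finally obtain k' where k': "k' \<in> Hom E K Y'" "y \<cdot> k' = k"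
    using conflation_ker[OF y H(1)] by blast
  note [simp] = k'(1)[THEN HomD]
  have d'k': "d' \<cdot> k' = r"
    by (rule conflation_mono[OF F(2) Comp_Hom[OF k'(1) HY(3)] HF(2)])
      (simp add: d'(2)[THEN reassoc] k'(2) F(3))
  have "d' \<cdot> (k' \<cdot> k1) = Zero E K' J" using conflationD(3)[OF F(1)] d'k'[THEN reassoc] by simp
  then obtain l where l: "l \<in> Hom E K' I" "m' \<cdot> l = k' \<cdot> k1"
    using conflation_ker[OF d'(1) Comp_Hom[OF HF(1) k'(1)]] by blast
  note [simp] = l(1)[THEN HomD]
  have po: "is_pushout E l k1 k' m'"
    by (rule is_pushout_commute[OF square_pushout[OF F(1) d'(1) k'(1) d'k' l(1)]]) (simp add: l(2))
  \<comment> \<open>\<open>l\<close> is monic because \<open>y \<cdot> (m' \<cdot> l)\<close> equals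
    \<open>k \<cdot> k1\<close>, and \<open>K'\<close> lies in \<open>A\<close>; so \<open>l\<close>
    is an inflation, and its pushout \<open>k'\<close> along \<open>k1\<close> has the same cokernel
    \<open>T\<close>.\<close>
  obtain t T where t: "conflation E l t K' I T"
  proof (rule mono_from_A[OF l(1) K'A])
    fix S x assume x: "x \<in> Hom E S K'" "l \<cdot> x = Zero E S I"
    note [simp] = x(1)[THEN HomD]
    have "k \<cdot> (k1 \<cdot> x) = y \<cdot> (m' \<cdot> (l \<cdot> x))"
      using l(2)[THEN reassoc, of x] k'(2)[THEN reassoc, of "k1 \<cdot> x"] by simp
    also have "\<dots> = k \<cdot> (k1 \<cdot> Zero E S K')" using x(2) by simp
    finally have "k1 \<cdot> x = k1 \<cdot> Zero E S K'"
      by (rule conflation_mono[OF p(1) Comp_Hom[OF x(1) HF(1)] Comp_Hom[OF Zero_Hom HF(1)], rotated 2]) auto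
    then show "x = Zero E S K'"
      by (rule conflation_mono[OF F(1) x(1) Zero_Hom, rotated 2]) auto
  qed auto
  obtain z where z: "conflation E k' z K Y' T" "z \<cdot> m' = t"
    using conflation_pushout[OF t HF(1) po k'(1) HY(2)] by blast
  have "conflation E (y \<cdot> k') p K Y Z" using p(1) k'(2) by simp
  then obtain j'' c'' where j'': "conflation E j'' c'' T Z C" "j'' \<cdot> z = p \<cdot> y"
    using noether[OF z(1) y] by blast
  note [simp] = conflationD(2)[OF z(1), THEN HomD] conflationD(1)[OF j''(1), THEN HomD]
  have "p \<cdot> m = j'' \<cdot> t"
    by (simp add: d'(3)[symmetric] z(2)[symmetric] j''(2)[THEN reassoc])
  then show ?thesis
    using admissible_modI[OF t j''(1) _ CB] K'A A_subset_B by blast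
qed

end

context serre_class
begin

interpretation op: serre_class "op_cat E" A B
  by (rule serre_class_op_cat) unfold_locales

interpretation A: serre_class E A A
  by (rule serre_class_A)

lemmas admissible_mod_deflation = op.admissible_mod_inflation[simplified]
lemmas admissible_mod_Comp_deflation = op.inflation_Comp_admissible_mod[simplified]

text \<open>In the composite of \<open>q\<close>, \<open>m\<close>, \<open>p\<close>,
  \<open>i\<close> only \<open>p \<cdot> m\<close> has the inflation before the deflation. It is
  admissible because the kernel of \<open>p\<close> lies in \<open>A\<close>, and the outer factors
  can then be attached.\<close>

lemma Comp_admissible_mod:
  assumes f: "admissible_mod E B X Y f" and s: "admissible_mod E A Y Z s"
  shows "admissible_mod E B X Z (s \<cdot> f)"
proof -
  obtain k q N I m c C where F: "conflation E k q N X I" "conflation E m c I Y C" "N \<in> B"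
      "C \<in> B" "f = m \<cdot> q"
    using f by (elim admissible_modE)
  obtain l p M J i d D where S: "conflation E l p M Y J" "conflation E i d J Z D" "M \<in> A"
      "D \<in> A" "s = i \<cdot> p"
    using s by (elim admissible_modE)
  note [simp] = conflationD(1,2)[OF F(1), THEN HomD] conflationD(1,2)[OF F(2), THEN HomD]
    conflationD(1,2)[OF S(1), THEN HomD] conflationD(1,2)[OF S(2), THEN HomD]
  have "admissible_mod E B I J (p \<cdot> m)"
    by (rule deflation_Comp_inflation[OF S(1,3) F(2,4)])
  then have "admissible_mod E B X Z (i \<cdot> ((p \<cdot> m) \<cdot> q))"
    using inflation_Comp_admissible_mod[OF S(2)] admissible_mod_Comp_deflation[OF F(1,3)] S(4) A_subset_B by blast
  then show ?thesis using F(5) S(5) by simp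
qed

text \<open>The image \<open>I\<close> of \<open>i \<cdot> f\<close> is killed by \<open>c\<close>,
  so \<open>c\<close> factors through the cokernel \<open>D\<close> by an epimorphism
  \<open>d\<close> onto \<open>C\<close>. As \<open>C\<close> lies in \<open>A\<close>,
  \<open>d\<close> is a deflation, and its kernel \<open>W\<close> is the cokernel of
  \<open>I\<close> in \<open>Y\<close>.\<close>

lemma admissible_mod_cancel_inflation:
  assumes f: "f \<in> Hom E X Y" and i: "conflation E i c Y Z C" "C \<in> A" and adm: "admissible_mod E B X Z (i \<cdot> f)"
  shows "admissible_mod E B X Y f"
proof -
  obtain n q N I m e D where F: "conflation E n q N X I" "conflation E m e I Z D" "N \<in> B"
      "D \<in> B" "i \<cdot> f = m \<cdot> q"
    using adm by (elim admissible_modE)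
  note H = conflationD(1,2)[OF F(1)] conflationD(1,2)[OF F(2)] conflationD(1,2)[OF i(1)]
  note [simp] = H[THEN HomD] f[THEN HomD]
  have "(c \<cdot> m) \<cdot> q = (c \<cdot> i) \<cdot> f" using F(5) by simp
  also have "\<dots> = Zero E I C \<cdot> q" using conflationD(3)[OF i(1)] by simp
  finally have "c \<cdot> m = Zero E I C"
    by (rule conflation_epi[OF F(1) Comp_Hom[OF H(3) H(6)] Zero_Hom, rotated 2]) auto
  then obtain d where d: "d \<in> Hom E D C" "d \<cdot> e = c"
    using conflation_coker[OF F(2) H(6)] by blast
  note [simp] = d(1)[THEN HomD]
  obtain w W where w: "conflation E w d W D C"
  proof (rule epi_to_A[OF d(1) i(2)])
    fix T x assume x: "x \<in> Hom E C T" "x \<cdot> d = Zero E D T"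
    note [simp] = x(1)[THEN HomD]
    have "x \<cdot> c = x \<cdot> d \<cdot> e" using d(2) by simp
    also have "\<dots> = Zero E C T \<cdot> c" using x(2) by (simp del: assoc_simp)
    finally show "x = Zero E C T"
      by (rule conflation_epi[OF i(1) x(1) Zero_Hom, rotated 2]) auto
  qed auto
  have "conflation E i (d \<cdot> e) Y Z C" using i(1) d(2) by simp
  then obtain e' m' where e': "conflation E m' e' I Y W" "i \<cdot> m' = m"
    using noether_op[OF w F(2)] by blast
  note H' = conflationD(1)[OF e'(1)]
  note [simp] = H'[THEN HomD]
  have "f = m' \<cdot> q"
    by (rule conflation_mono[OF i(1) f Comp_Hom[OF H(2) H']]) (simp add: e'(2)[THEN reassoc] F(5))
  moreover have "W \<in> B" using B_conflation[OF w] F(4) by blast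
  ultimately show ?thesis using admissible_modI[OF F(1) e'(1) F(3)] by blast
qed

text \<open>Over the image \<open>I\<close> of \<open>p \<cdot> f\<close>, the morphism \<open>f\<close> is a pushout of the map \<open>l\<close> between the
  kernels; as its codomain lies in \<open>A\<close>, \<open>l\<close> is admissible.\<close>

lemma admissible_mod_cancel_deflation:
  assumes f: "f \<in> Hom E X Y" and p: "conflation E k p K Y Z" "K \<in> A" and adm: "admissible_mod E B X Z (p \<cdot> f)"
  shows "admissible_mod E B X Y f"
proof -
  obtain n q L I m c D where F: "conflation E n q L X I" "conflation E m c I Z D" "L \<in> B"
      "D \<in> B" "p \<cdot> f = m \<cdot> q"
    using adm by (elim admissible_modE)
  note H = conflationD(1,2)[OF F(1)] conflationD(1,2)[OF F(2)] conflationD(1,2)[OF p(1)]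
  note [simp] = H[THEN HomD] f[THEN HomD]
  \<comment> \<open>\<open>Y'\<close> is the preimage under \<open>p\<close> of the image
    \<open>I\<close>. It receives \<open>f\<close>, and \<open>p\<close> restricts to a deflation
    \<open>p'\<close> of \<open>Y'\<close> onto \<open>I\<close> with the same kernel
    \<open>K\<close>.\<close>
  obtain y Y' where y: "conflation E y (c \<cdot> p) Y' Y D"
    using conflation_Comp_deflation[OF p(1) F(2)] by blast
  obtain p' k' where p': "conflation E k' p' K Y' I" "m \<cdot> p' = p \<cdot> y" "y \<cdot> k' = k"
    using noether_op[OF F(2) p(1) y] by blast
  note HY = conflationD(1)[OF y] conflationD(1,2)[OF p'(1)]
  note [simp] = HY[THEN HomD]
  have "(c \<cdot> p) \<cdot> f = (c \<cdot> m) \<cdot> q" using F(5) by simp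
  also have "\<dots> = Zero E X D" using conflationD(3)[OF F(2)] by simp
  finally obtain f' where f': "f' \<in> Hom E X Y'" "y \<cdot> f' = f"
    using conflation_ker[OF y f] by blast
  note [simp] = f'(1)[THEN HomD]
  have p'f': "p' \<cdot> f' = q"
    by (rule conflation_mono[OF F(2) Comp_Hom[OF f'(1) HY(3)] H(2)])
      (simp add: p'(2)[THEN reassoc] f'(2) F(5))
  have "p' \<cdot> (f' \<cdot> n) = Zero E L I" using conflationD(3)[OF F(1)] p'f'[THEN reassoc] by simp
  then obtain l where l: "l \<in> Hom E L K" "k' \<cdot> l = f' \<cdot> n"
    using conflation_ker[OF p'(1) Comp_Hom[OF H(1) f'(1)]] by blast
  note [simp] = l(1)[THEN HomD]
  obtain n0 r N J j d C where G: "conflation E n0 r N L J" "conflation E j d J K C" "C \<in> A" "l = j \<cdot> r"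
    using morphism_to_A[OF l(1) p(2)] by metis
  note HG = conflationD(1,2)[OF G(1)] conflationD(1,2)[OF G(2)]
  note [simp] = HG[THEN HomD]
  have NB: "N \<in> B" using B_conflation[OF G(1)] F(3) by blast
  \<comment> \<open>The kernel \<open>N\<close> of \<open>l\<close> is going to be the kernel of
    \<open>f\<close>. The quotient \<open>X1\<close> of \<open>X\<close> by \<open>N\<close> is an
    extension of \<open>I\<close> by \<open>J\<close>, while \<open>Y'\<close> is one of
    \<open>I\<close> by \<open>K\<close>; hence the induced \<open>f1\<close> is a pushout of the
    inflation \<open>j\<close>.\<close>
  obtain pi X1 where pi: "conflation E (n \<cdot> n0) pi N X X1"
    using conflation_Comp_inflation[OF G(1) F(1)] by blast
  obtain j' c' where j': "conflation E j' c' J X1 I" "j' \<cdot> r = pi \<cdot> n" "c' \<cdot> pi = q"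
    using noether[OF G(1) F(1) pi] by blast
  note HP = conflationD(2)[OF pi] conflationD(1,2)[OF j'(1)]
  note [simp] = HP[THEN HomD]
  have "f' \<cdot> (n \<cdot> n0) = k' \<cdot> (j \<cdot> (r \<cdot> n0))" using l(2)[THEN reassoc, of n0] G(4) by simp
  also have "\<dots> = Zero E N Y'" using conflationD(3)[OF G(1)] by simp
  finally obtain f1 where f1: "f1 \<in> Hom E X1 Y'" "f1 \<cdot> pi = f'"
    using conflation_coker[OF pi f'(1)] by blast
  note [simp] = f1(1)[THEN HomD]
  have "p' \<cdot> f1 = c'"
    by (rule conflation_epi[OF pi Comp_Hom[OF f1(1) HY(3)] HP(3)]) (simp add: f1(2) j'(3) p'f')
  moreover have "f1 \<cdot> j' = k' \<cdot> j"
    by (rule conflation_epi[OF G(1) Comp_Hom[OF HP(2) f1(1)] Comp_Hom[OF HG(3) HY(2)]])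
      (simp add: j'(2) f1(2)[THEN reassoc] G(4)[symmetric] l(2))
  ultimately have "is_pushout E j j' f1 k'"
    using is_pushout_commute[OF square_pushout[OF j'(1) p'(1) f1(1) _ HG(3)]] by blast
  then obtain g where g: "conflation E f1 g X1 Y' C"
    using conflation_pushout[OF G(2) HP(2) _ f1(1) HY(2)] by blast
  have "admissible_mod E B X Y' (f1 \<cdot> pi)"
    using admissible_modI[OF pi g NB] G(3) A_subset_B by blast
  then have "admissible_mod E B X Y (y \<cdot> (f1 \<cdot> pi))"
    using inflation_Comp_admissible_mod[OF y F(4)] by blast
  then show ?thesis using f1(2) f'(2) by simp
qed

lemma admissible_mod_cancel:
  assumes f: "f \<in> Hom E X Y" and s: "admissible_mod E A Y Z s" and sf: "admissible_mod E B X Z (s \<cdot> f)"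
  shows "admissible_mod E B X Y f"
proof -
  obtain l p M J i d D where S: "conflation E l p M Y J" "conflation E i d J Z D" "M \<in> A"
      "D \<in> A" "s = i \<cdot> p"
    using s by (elim admissible_modE)
  note [simp] = conflationD(1,2)[OF S(1), THEN HomD] conflationD(1,2)[OF S(2), THEN HomD] f[THEN HomD]
  have "admissible_mod E B X J (p \<cdot> f)"
    using admissible_mod_cancel_inflation[OF Comp_Hom[OF f conflationD(2)[OF S(1)]] S(2,4)] sf S(5) by simp
  then show ?thesis using admissible_mod_cancel_deflation[OF f S(1,3)] by blast
qed

end

context serre_class
begin

interpretation op: serre_class "op_cat E" A B
  by (rule serre_class_op_cat) unfold_locales

lemmas admissible_mod_Comp = op.Comp_admissible_mod[simplified]
lemmas admissible_mod_cancel_right = op.admissible_mod_cancel[simplified]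
end

section \<open>The morphisms inverted by the localization\<close>

context exact_category
begin

text \<open>As \<open>m\<close> is monic, \<open>m \<cdot> q\<close> and \<open>q\<close> have the
  same kernels. This relates kernels given by their universal property alone to the conflations of a
  chosen factorization.\<close>

lemma kernel_of_admissible:
  assumes q: "conflation E k q K X I" and m: "conflation E m c I Y C"
  shows "is_kernel E (m \<cdot> q) k' \<Longrightarrow> conflation E k' q (Dom E k') X I" and "is_kernel E (m \<cdot> q) k"
proof -
  note H = conflationD(1,2)[OF q] conflationD(1)[OF m]
  note [simp] = H[THEN HomD]
  have ker_iff: "m \<cdot> (q \<cdot> h) = Zero E T Y \<longleftrightarrow> q \<cdot> h = Zero E T I" if h: "h \<in> Hom E T X" for h T
  proof
    assume "m \<cdot> (q \<cdot> h) = Zero E T Y"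
    then show "q \<cdot> h = Zero E T I"
      by (intro conflation_mono[OF m Comp_Hom[OF h H(2)] Zero_Hom]) (use h[THEN HomD] in auto)
  qed (use h[THEN HomD] in auto)
  show "conflation E k' q (Dom E k') X I" if k': "is_kernel E (m \<cdot> q) k'"
  proof -
    obtain K' where K': "Dom E k' = K'" by blast
    have T: "k' \<in> Hom E K' X" "(m \<cdot> q) \<cdot> k' = Zero E K' Y"
      using k' K' by (auto simp: is_kernel_def composable_def Hom_def)
    note [simp] = HomD[OF T(1)]
    have ex1: "\<exists>!u. u \<in> Hom E T (K') \<and> k' \<cdot> u = h" if "h \<in> Hom E T X" "q \<cdot> h = Zero E T I" for h T
    proof -
      note [simp] = HomD[OF that(1)]
      have "m \<cdot> q \<cdot> h = Zero E T (Cod E (m \<cdot> q))" "h \<in> Hom E T (Dom E (m \<cdot> q))"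
        using that by simp_all
      then show ?thesis using k' unfolding is_kernel_def K' by blast
    qed
    have qk: "q \<cdot> k' = Zero E (K') I" using ker_iff[OF T(1)] T(2) by simp
    show "conflation E k' q (Dom E k') X I" unfolding K'
    proof (rule conflation_kernel_unique[OF q T(1) qk])
      fix T x y assume xy: "x \<in> Hom E T (K')" "y \<in> Hom E T (K')" "k' \<cdot> x = k' \<cdot> y"
      note [simp] = xy(1,2)[THEN HomD]
      have "q \<cdot> (k' \<cdot> y) = Zero E T I" by (simp add: qk[THEN reassoc])
      with ex1[OF Comp_Hom[OF xy(2) T(1)]] xy show "x = y" by auto
    qed (use ex1 in blast)
  qed
  show "is_kernel E (m \<cdot> q) k"
    unfolding is_kernel_def
  proof (intro conjI allI ballI impI)
    show "composable E k (m \<cdot> q)" by (simp add: composable_def)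
    show "m \<cdot> q \<cdot> k = Zero E (Dom E k) (Cod E (m \<cdot> q))" using conflationD(3)[OF q] by simp
    fix T h assume h: "h \<in> Hom E T (Dom E (m \<cdot> q))" "m \<cdot> q \<cdot> h = Zero E T (Cod E (m \<cdot> q))"
    then have h': "h \<in> Hom E T X" by simp
    then have "q \<cdot> h = Zero E T I" using ker_iff[OF h'] h(2) HomD[OF h'] by simp
    then obtain u where "u \<in> Hom E T K" "k \<cdot> u = h" using conflation_ker[OF q h'] by blast
    then show "\<exists>!u. u \<in> Hom E T (Dom E k) \<and> k \<cdot> u = h"
      using conflation_mono[OF q] by auto
  qed
qed

end

context exact_category
begin

interpretation op: exact_category "op_cat E"
  by (rule exact_category_op_cat) unfold_locales

lemmas cokernel_of_admissible = op.kernel_of_admissible[simplified]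

lemma admissible_iff:
  assumes "f \<in> Hom E X Y"
  shows "admissible E f \<longleftrightarrow> admissible_mod E (Obj E) X Y f"
proof
  assume "admissible E f"
  then obtain I where "admissible_with_image E f I" by (auto simp: admissible_def)
  then obtain k r K j c C where F: "conflation E k r K X I" "conflation E j c I Y C" "f = j \<cdot> r"
    using admissible_with_imageE assms by metis
  then show "admissible_mod E (Obj E) X Y f"
    using admissible_modI[OF F(1,2)] HomD[OF conflationD(1)[OF F(1)]] HomD[OF conflationD(2)[OF F(2)]]
    by blast
next
  assume "admissible_mod E (Obj E) X Y f"
  then obtain k q N I m c C where F: "conflation E k q N X I" "conflation E m c I Y C" "f = m \<cdot> q"
    by (elim admissible_modE)
  then have "deflation E q" "inflation E m" "Cod E q = I" "Dom E m = I"
    by (auto simp: conflation_def inflation_def deflation_def Hom_def)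
  with F(3) show "admissible E f"
    by (auto simp: admissible_def admissible_with_image_def)
qed

end

context percolating_exact_category
begin

interpretation A: serre_class E A A
  by (rule serre_class_A)

lemma Sigma_perc_iff:
  assumes "s \<in> Hom E X Y"
  shows "s \<in> Sigma_perc E A \<longleftrightarrow> admissible_mod E A X Y s"
proof
  assume s: "s \<in> Sigma_perc E A"
  then have "admissible_mod E (Obj E) X Y s" using admissible_iff[OF assms] by (simp add: Sigma_perc_def)
  then obtain k q N I m c C where F: "conflation E k q N X I" "conflation E m c I Y C" "s = m \<cdot> q"
    by (elim admissible_modE)
  obtain k' c' where "is_kernel E s k'" "Dom E k' \<in> A" "is_cokernel E s c'" "Cod E c' \<in> A"
    using s by (auto simp: Sigma_perc_def)
  then show "admissible_mod E A X Y s"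
    using admissible_modI[OF kernel_of_admissible(1)[OF F(1,2)] cokernel_of_admissible(1)[OF F(2,1)]] F(3)
    by blast
next
  assume s: "admissible_mod E A X Y s"
  then obtain k q N I m c C where F: "conflation E k q N X I" "conflation E m c I Y C" "N \<in> A" "C \<in> A" "s = m \<cdot> q"
    by (elim admissible_modE)
  have "admissible_mod E (Obj E) X Y s"
    using admissible_modI[OF F(1,2)] F(3-5) A_Obj by blast
  then have "admissible E s" using admissible_iff[OF assms] by simp
  moreover have "Dom E k = N" "Cod E c = C" using F(1,2) by (auto simp: conflation_def Hom_def)
  ultimately show "s \<in> Sigma_perc E A"
    using kernel_of_admissible(2)[OF F(1,2)] cokernel_of_admissible(2)[OF F(2,1)] F(3-5) HomD[OF assms]
    unfolding Sigma_perc_def by blast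
qed

section \<open>Calculus of right fractions and saturation\<close>

lemma admissible_mod_Ide: "X \<in> Obj E \<Longrightarrow> admissible_mod E A X X (Ide E X)"
  using ex_conflation_inflation[OF inflation_Ide] cokernel_Ide_in_A A.admissible_mod_inflation by fastforce

text \<open>The pullback is the kernel \<open>k\<close> of \<open>c \<cdot> f\<close>, which exists
  because \<open>C\<close> lies in \<open>A\<close>; the cokernel of \<open>k\<close> is the image
  of \<open>c \<cdot> f\<close>, again in \<open>A\<close>. Existence of factorizations and the
  monomorphism property of \<open>k\<close> are stated separately, in the form in which saturation
  uses them.\<close>

lemma inflation_pullback_A:
  assumes i: "conflation E i c X Y C" "C \<in> A" and f: "f \<in> Hom E W Y"
  obtains k K g where "admissible_mod E A K W k" "g \<in> Hom E K X" "i \<cdot> g = f \<cdot> k"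
    "\<forall>T. \<forall>a \<in> Hom E T X. \<forall>b \<in> Hom E T W. i \<cdot> a = f \<cdot> b \<longrightarrow> (\<exists>u \<in> Hom E T K. g \<cdot> u = a \<and> k \<cdot> u = b)"
    "\<forall>T. \<forall>x \<in> Hom E T K. k \<cdot> x = Zero E T W \<longrightarrow> x = Zero E T K"
proof -
  note H = conflationD(1,2)[OF i(1)]
  note [simp] = H[THEN HomD] f[THEN HomD]
  obtain k r K J j d D where F: "conflation E k r K W J" "conflation E j d J C D" "J \<in> A" "c \<cdot> f = j \<cdot> r"
    using morphism_to_A[OF Comp_Hom[OF f H(2)] i(2)] by metis
  note HF = conflationD(1,2)[OF F(1)] conflationD(1)[OF F(2)]
  note [simp] = HF[THEN HomD]
  have "c \<cdot> (f \<cdot> k) = Zero E K C" using F(4)[THEN reassoc, of k] conflationD(3)[OF F(1)] by simp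
  then obtain g where g: "g \<in> Hom E K X" "i \<cdot> g = f \<cdot> k"
    using conflation_ker[OF i(1) Comp_Hom[OF HF(1) f]] by blast
  note [simp] = g(1)[THEN HomD]
  have ex: "\<exists>u \<in> Hom E T K. g \<cdot> u = a \<and> k \<cdot> u = b"
    if ab: "a \<in> Hom E T X" "b \<in> Hom E T W" "i \<cdot> a = f \<cdot> b" for T a b
  proof -
    note [simp] = ab(1,2)[THEN HomD]
    have "j \<cdot> (r \<cdot> b) = c \<cdot> (i \<cdot> a)" using F(4)[THEN reassoc, of b] ab(3) by simp
    also have "\<dots> = Zero E T C" using conflationD(3)[OF i(1), THEN reassoc, of a] by simp
    finally have "r \<cdot> b = Zero E T J"
      by (intro conflation_mono[OF F(2) Comp_Hom[OF ab(2) HF(2)] Zero_Hom]) auto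
    then obtain u where u: "u \<in> Hom E T K" "k \<cdot> u = b"
      using conflation_ker[OF F(1) ab(2)] by blast
    note [simp] = u(1)[THEN HomD]
    have "g \<cdot> u = a"
      by (rule conflation_mono[OF i(1) Comp_Hom[OF u(1) g(1)] ab(1)]) (simp add: g(2)[THEN reassoc] u ab)
    with u show ?thesis by blast
  qed
  have zero: "x = Zero E T K" if x: "x \<in> Hom E T K" "k \<cdot> x = Zero E T W" for T x
    by (rule conflation_mono[OF F(1) x(1) Zero_Hom]) (use HomD[OF x(1)] x(2) in auto)
  show thesis using that[OF A.admissible_mod_inflation[OF F(1,3)] g] ex zero by blast
qed

text \<open>Write \<open>s\<close> as a deflation followed by an inflation and pull back along each
  in turn: the inflation by \<open>inflation_pullback_A\<close>, the deflation by the axiom, which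
  keeps its kernel \<open>M\<close> in \<open>A\<close>.\<close>

lemma right_Ore:
  assumes s: "admissible_mod E A X Y s" and f: "f \<in> Hom E W Y"
  obtains V t g where "admissible_mod E A V W t" "g \<in> Hom E V X" "s \<cdot> g = f \<cdot> t"
proof -
  obtain l p M I i c C where S: "conflation E l p M X I" "conflation E i c I Y C" "M \<in> A" "C \<in> A" "s = i \<cdot> p"
    using s by (elim admissible_modE)
  obtain k K g where g: "admissible_mod E A K W k" "g \<in> Hom E K I" "i \<cdot> g = f \<cdot> k"
    using inflation_pullback_A[OF S(2,4) f] by metis
  obtain V p' g' l' where P: "conflation E l' p' M V K" "g' \<in> Hom E V X" "p \<cdot> g' = g \<cdot> p'"
    using ex_pullback[OF S(1) g(2)] by metis
  note [simp] = conflationD(2)[OF S(1), THEN HomD] conflationD(1)[OF S(2), THEN HomD] f[THEN HomD]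
    A.admissible_mod_Hom[OF g(1), THEN HomD] g(2)[THEN HomD] P(2)[THEN HomD] conflationD(2)[OF P(1), THEN HomD]
  have "s \<cdot> g' = f \<cdot> (k \<cdot> p')" by (simp add: S(5) P(3) g(3)[THEN reassoc])
  then show thesis
    using that[OF A.admissible_mod_Comp_deflation[OF P(1) S(3) g(1)] P(2)] by blast
qed

text \<open>The difference of \<open>x\<close> and \<open>y\<close> factors through the kernel
  \<open>M\<close> of \<open>s\<close> by a morphism \<open>e\<close>. Since \<open>M\<close> lies
  in \<open>A\<close>, \<open>e\<close> is admissible, and its kernel lies in Sigma because its
  image is in \<open>A\<close>.\<close>

lemma right_cancel:
  assumes s: "admissible_mod E A X Y s" and xy: "x \<in> Hom E T X" "y \<in> Hom E T X" "s \<cdot> x = s \<cdot> y"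
  obtains V u where "admissible_mod E A V T u" "x \<cdot> u = y \<cdot> u"
proof -
  obtain l p M I i c C where S: "conflation E l p M X I" "conflation E i c I Y C" "M \<in> A" "C \<in> A" "s = i \<cdot> p"
    using s by (elim admissible_modE)
  note H = conflationD(1,2)[OF S(1)] conflationD(1)[OF S(2)]
  note [simp] = H[THEN HomD] xy(1,2)[THEN HomD]
  have px: "p \<cdot> x = p \<cdot> y"
    by (rule conflation_mono[OF S(2) Comp_Hom[OF xy(1) H(2)] Comp_Hom[OF xy(2) H(2)]]) (use xy(3) S(5) in simp)
  define d where "d = hom_diff E x y"
  have d: "d \<in> Hom E T X" unfolding d_def by (rule diff_Hom[OF xy(1,2)])
  have "p \<cdot> d = Zero E T I"
    unfolding d_def Comp_diff_left[OF xy(1,2) H(2)]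
    using diff_eq_Zero_iff[OF Comp_Hom[OF xy(1) H(2)] Comp_Hom[OF xy(2) H(2)]] px by simp
  then obtain e where e: "e \<in> Hom E T M" "l \<cdot> e = d" using conflation_ker[OF S(1) d] by blast
  obtain k r K J j c' C' where F: "conflation E k r K T J" "conflation E j c' J M C'" "J \<in> A" "e = j \<cdot> r"
    using morphism_to_A[OF e(1) S(3)] by metis
  note HF = conflationD(1,2)[OF F(1)] conflationD(1)[OF F(2)]
  note [simp] = HF[THEN HomD] e(1)[THEN HomD]
  have "d \<cdot> k = Zero E K X"
    by (simp add: e(2)[symmetric] F(4) conflationD(3)[OF F(1)])
  then have "x \<cdot> k = y \<cdot> k"
    using Comp_diff_right[OF xy(1,2) HF(1)] diff_eq_Zero_iff[OF Comp_Hom[OF HF(1) xy(1)] Comp_Hom[OF HF(1) xy(2)]]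
    unfolding d_def by simp
  then show thesis using that[OF A.admissible_mod_inflation[OF F(1,3)]] by blast
qed

text \<open>After dividing out the kernel of \<open>f\<close>, which lies in \<open>A\<close> because \<open>h \<cdot> f\<close> kills it, the monomorphism
  \<open>f'\<close> is invertible over the image of \<open>f \<cdot> g\<close>, and cancellation applies.\<close>

lemma two_out_of_six:
  assumes f: "f \<in> Hom E X Y" and h: "h \<in> Hom E Y V" and g: "g \<in> Hom E W X"
    and hf: "admissible_mod E A X V (h \<cdot> f)" and fg: "admissible_mod E A W Y (f \<cdot> g)"
  shows "admissible_mod E A X Y f"
proof -
  note [simp] = f[THEN HomD] g[THEN HomD] h[THEN HomD]
  obtain n q N I m c C where F: "conflation E n q N X I" "conflation E m c I V C" "N \<in> A" "h \<cdot> f = m \<cdot> q"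
    using hf by (elim admissible_modE)
  note HF = conflationD(1,2)[OF F(1)] conflationD(1)[OF F(2)]
  note [simp] = HF[THEN HomD]
  obtain n' r N' J j D d where G: "conflation E n' r N' N J" "conflation E j d J Y D" "N' \<in> A" "f \<cdot> n = j \<cdot> r"
    using morphism_from_A[OF Comp_Hom[OF HF(1) f] F(3)] by metis
  note HG = conflationD(1,2)[OF G(1)] conflationD(1)[OF G(2)]
  note [simp] = HG[THEN HomD]
  \<comment> \<open>The kernel of \<open>f\<close> lies inside the kernel \<open>N\<close> of
    \<open>h \<cdot> f\<close>, so it is the kernel \<open>N'\<close> of \<open>f \<cdot> n\<close>;
    the latter morphism is admissible since \<open>N\<close> lies in \<open>A\<close>.\<close>
  obtain pi X1 where pi: "conflation E (n \<cdot> n') pi N' X X1"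
    using conflation_Comp_inflation[OF G(1) F(1)] by blast
  note Hpi = conflationD(2)[OF pi]
  note [simp] = Hpi[THEN HomD]
  have "f \<cdot> (n \<cdot> n') = Zero E N' Y" using G(4)[THEN reassoc, of n'] conflationD(3)[OF G(1)] by simp
  then obtain f' where f': "f' \<in> Hom E X1 Y" "f' \<cdot> pi = f" using conflation_coker[OF pi f] by blast
  note [simp] = f'(1)[THEN HomD]
  have mono: "x = Zero E T X1" if x: "x \<in> Hom E T X1" "f' \<cdot> x = Zero E T Y" for T x
  proof -
    note [simp] = x(1)[THEN HomD]
    \<comment> \<open>The pullback of \<open>pi\<close> lifts \<open>x\<close> to a morphism
      \<open>x'\<close> into \<open>X\<close> over the deflation \<open>e\<close>. As
      \<open>e\<close> is epic, it suffices that \<open>x \<cdot> e\<close> vanishes.\<close>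
    obtain P e x' k where P: "conflation E k e N' P T" "x' \<in> Hom E P X" "pi \<cdot> x' = x \<cdot> e"
      using ex_pullback[OF pi x(1)] by metis
    note HP = conflationD(2)[OF P(1)]
    note [simp] = HP[THEN HomD] P(2)[THEN HomD]
    have "f \<cdot> x' = f' \<cdot> (x \<cdot> e)" using f'(2)[THEN reassoc, of x'] P(3) by simp
    also have "\<dots> = Zero E P Y" using x(2)[THEN reassoc, of e] by simp
    finally have fx': "f \<cdot> x' = Zero E P Y" .
    then have "m \<cdot> (q \<cdot> x') = Zero E P V" using F(4)[THEN reassoc, of x'] by simp
    then have "q \<cdot> x' = Zero E P I"
      by (intro conflation_mono[OF F(2) Comp_Hom[OF P(2) HF(2)] Zero_Hom]) auto
    then obtain y where y: "y \<in> Hom E P N" "n \<cdot> y = x'" using conflation_ker[OF F(1) P(2)] by blast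
    note [simp] = y(1)[THEN HomD]
    have "j \<cdot> (r \<cdot> y) = Zero E P Y" using G(4)[THEN reassoc, of y] y(2) fx' by simp
    then have "r \<cdot> y = Zero E P J"
      by (intro conflation_mono[OF G(2) Comp_Hom[OF y(1) HG(2)] Zero_Hom]) auto
    then obtain z where z: "z \<in> Hom E P N'" "n' \<cdot> z = y" using conflation_ker[OF G(1) y(1)] by blast
    note [simp] = z(1)[THEN HomD]
    have "x \<cdot> e = (pi \<cdot> (n \<cdot> n')) \<cdot> z" by (simp add: P(3)[symmetric] y(2)[symmetric] z(2)[symmetric])
    also have "\<dots> = Zero E T X1 \<cdot> e" unfolding conflationD(3)[OF pi] by simp
    finally show ?thesis by (intro conflation_epi[OF P(1) x(1) Zero_Hom]) auto
  qed
  obtain n2 q2 N2 Y0 m2 c2 C2 where S: "conflation E n2 q2 N2 W Y0" "conflation E m2 c2 Y0 Y C2" "C2 \<in> A"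
      "f \<cdot> g = m2 \<cdot> q2"
    using fg by (elim admissible_modE)
  note HS = conflationD(2)[OF S(1)] conflationD(1,2)[OF S(2)]
  note [simp] = HS[THEN HomD]
  obtain k K f1 where K: "admissible_mod E A K X1 k" "f1 \<in> Hom E K Y0" "m2 \<cdot> f1 = f' \<cdot> k"
    and K_ex: "\<forall>T. \<forall>a \<in> Hom E T Y0. \<forall>b \<in> Hom E T X1. m2 \<cdot> a = f' \<cdot> b \<longrightarrow>
      (\<exists>u \<in> Hom E T K. f1 \<cdot> u = a \<and> k \<cdot> u = b)"
    and K_mono: "\<forall>T. \<forall>x \<in> Hom E T K. k \<cdot> x = Zero E T X1 \<longrightarrow> x = Zero E T K"
    by (rule inflation_pullback_A[OF S(2,3) f'(1)])
  note [simp] = A.admissible_mod_Hom[OF K(1), THEN HomD] K(2)[THEN HomD]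
  have "m2 \<cdot> q2 = f' \<cdot> (pi \<cdot> g)" using f'(2)[THEN reassoc, of g] S(4) by simp
  then obtain u where u: "u \<in> Hom E W K" "f1 \<cdot> u = q2"
    using K_ex HS(1) Comp_Hom[OF g Hpi] by blast
  \<comment> \<open>\<open>f1\<close> is the pullback of \<open>f'\<close> along the inflation
    \<open>m2\<close>. It is monic since \<open>f'\<close> and \<open>k\<close> are, and the
    deflation \<open>q2\<close> factors through it.\<close>
  have "is_iso E f1"
  proof (rule mono_deflation_iso[OF S(1) K(2) u])
    fix T x assume x: "x \<in> Hom E T K" "f1 \<cdot> x = Zero E T Y0"
    note [simp] = x(1)[THEN HomD]
    have "f' \<cdot> (k \<cdot> x) = Zero E T Y" using K(3)[THEN reassoc, of x] x(2) by simp
    then have "k \<cdot> x = Zero E T X1" using mono[OF Comp_Hom[OF x(1) A.admissible_mod_Hom[OF K(1)]]] by blast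
    then show "x = Zero E T K" using K_mono x(1) by blast
  qed
  then obtain v where v: "v \<in> Hom E Y0 K" "f1 \<cdot> v = Ide E Y0" "is_iso E v"
    using is_isoE[OF _ K(2)] by metis
  note [simp] = v(1)[THEN HomD]
  have "conflation E (m2 \<cdot> f1) c2 K Y C2"
    by (rule conflation_isoI[OF S(2) Comp_Hom[OF K(2) HS(2)] HS(3) v(1) Ide_Hom Ide_Hom v(3) is_iso_Ide is_iso_Ide])
      (simp_all add: v)
  then have "admissible_mod E A K Y (f' \<cdot> k)" using A.admissible_mod_inflation[OF _ S(3)] K(3) by simp
  then have "admissible_mod E A X1 Y f'" using A.admissible_mod_cancel_right[OF f'(1) K(1)] by blast
  then show ?thesis using A.admissible_mod_Comp_deflation[OF pi G(3)] f'(2) by metis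
qed

end


section \<open>Lifting zigzags\<close>

text \<open>\<open>zz_lift C w s f\<close>: there are morphisms from \<open>Dom C s\<close> to all vertices of the zigzag \<open>w\<close>, commuting with its
  steps, the first of which is \<open>s\<close> and the last of which is \<open>f\<close>.  If \<open>s \<in> S\<close>, then \<open>w\<close> represents the fraction \<open>f s\<^sup>-\<^sup>1\<close>.\<close>

fun zz_lift :: "('o, 'm, 'z) cat_scheme \<Rightarrow> 'm step list \<Rightarrow> 'm \<Rightarrow> 'm \<Rightarrow> bool" where
  "zz_lift C [] s f \<longleftrightarrow> f = s"
| "zz_lift C (Fwd h # w) s f \<longleftrightarrow> zz_lift C w (h \<cdot>\<^bsub>C\<^esub> s) f"
| "zz_lift C (Inv t # w) s f \<longleftrightarrow> (\<exists>r \<in> Hom C (Dom C s) (Dom C t). t \<cdot>\<^bsub>C\<^esub> r = s \<and> zz_lift C w r f)"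

lemma zz_lift_append: "zz_lift C (v @ w) s f \<longleftrightarrow> (\<exists>g. zz_lift C v s g \<and> zz_lift C w g f)"
  by (induction C v s f rule: zz_lift.induct) auto

context category
begin

lemma zz_lift_Hom:
  "zigzag C S X w Y \<Longrightarrow> s \<in> Hom C W X \<Longrightarrow> zz_lift C w s f \<Longrightarrow> f \<in> Hom C W Y"
proof (induction w arbitrary: X s)
  case (Cons st w)
  show ?case
  proof (cases st)
    case (Fwd h)
    then obtain X' where h: "h \<in> Hom C X X'" "zigzag C S X' w Y" using Cons.prems(1) by (auto simp: Hom_def)
    show ?thesis using Cons.IH[OF h(2) Comp_Hom[OF Cons.prems(2) h(1)]] Cons.prems(3) Fwd by simp
  next
    case (Inv t)
    then obtain X' where t: "t \<in> Hom C X' X" "zigzag C S X' w Y" using Cons.prems(1) by (auto simp: Hom_def)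
    then show ?thesis
      using Cons.IH[OF t(2)] Cons.prems(3) Inv HomD[OF t(1)] HomD[OF Cons.prems(2)] by auto
  qed
qed auto

lemma zz_lift_Comp:
  "zigzag C S X w Y \<Longrightarrow> s \<in> Hom C W X \<Longrightarrow> zz_lift C w s f \<Longrightarrow> u \<in> Hom C V W \<Longrightarrow>
   zz_lift C w (s \<cdot> u) (f \<cdot> u)"
proof (induction w arbitrary: X s)
  case (Cons st w)
  note [simp] = Cons.prems(2,4)[THEN HomD]
  show ?case
  proof (cases st)
    case (Fwd h)
    then obtain X' where h: "h \<in> Hom C X X'" "zigzag C S X' w Y" using Cons.prems(1) by (auto simp: Hom_def)
    note [simp] = h(1)[THEN HomD]
    have "zz_lift C w ((h \<cdot> s) \<cdot> u) (f \<cdot> u)"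
      by (rule Cons.IH[OF h(2) Comp_Hom[OF Cons.prems(2) h(1)] _ Cons.prems(4)]) (use Cons.prems Fwd in simp)
    then show ?thesis using Fwd by simp
  next
    case (Inv t)
    then obtain X' where t: "t \<in> Hom C X' X" "zigzag C S X' w Y" using Cons.prems(1) by (auto simp: Hom_def)
    then obtain r where r: "r \<in> Hom C W X'" "t \<cdot> r = s" "zz_lift C w r f" using Cons.prems(3) Inv HomD[OF t(1)] by auto
    note [simp] = t(1)[THEN HomD] r(1)[THEN HomD]
    have "zz_lift C w (r \<cdot> u) (f \<cdot> u)" by (rule Cons.IH[OF t(2) r(1,3) Cons.prems(4)])
    then show ?thesis using Inv r(2) by (auto intro!: exI[of _ "r \<cdot> u"] simp: Hom_def)
  qed
qed auto

text \<open>A step \<open>Inv t\<close> is absorbed by the lift \<open>r\<close>: as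
  \<open>t \<cdot> r\<close> equals \<open>s\<close>, traversing \<open>s\<close> and then
  \<open>t\<close> backwards amounts to \<open>r\<close>.\<close>

lemma zz_eq_lift:
  "zigzag C S X w Y \<Longrightarrow> s \<in> Hom C W X \<Longrightarrow> zz_lift C w s f \<Longrightarrow> zz_eq C S W Y (Fwd s # w) [Fwd f]"
proof (induction w arbitrary: X s)
  case Nil
  then show ?case using HomD[OF Nil(2)] by (auto intro: zz_eq.refl)
next
  case (Cons st w)
  note [simp] = Cons.prems(2)[THEN HomD]
  show ?case
  proof (cases st)
    case (Fwd h)
    then obtain X' where h: "h \<in> Hom C X X'" "zigzag C S X' w Y" using Cons.prems(1) by (auto simp: Hom_def)
    have 1: "zz_eq C S W Y ([Fwd s, Fwd h] @ w) ([Fwd (h \<cdot> s)] @ w)"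
      by (rule zz_eq.append[OF zz_eq.comp[OF Cons.prems(2) h(1)] zz_eq.refl[OF h(2)]])
    have 2: "zz_eq C S W Y (Fwd (h \<cdot> s) # w) [Fwd f]"
      by (rule Cons.IH[OF h(2) Comp_Hom[OF Cons.prems(2) h(1)]]) (use Cons.prems Fwd in simp)
    show ?thesis using zz_eq.trans[OF 1[simplified] 2] Fwd by simp
  next
    case (Inv t)
    then obtain X' where t: "t \<in> Hom C X' X" "zigzag C S X' w Y" "t \<in> S" using Cons.prems(1) by (auto simp: Hom_def)
    then obtain r where r: "r \<in> Hom C W X'" "t \<cdot> r = s" "zz_lift C w r f" using Cons.prems(3) Inv HomD[OF t(1)] by auto
    note [simp] = t(1)[THEN HomD] r(1)[THEN HomD]
    have tw: "zigzag C S X (Inv t # w) Y" using t by simp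
    have rr: "zigzag C S W [Fwd r] X'" by simp
    have 1: "zz_eq C S W Y ([Fwd r, Fwd t] @ (Inv t # w)) ([Fwd s] @ (Inv t # w))"
      using zz_eq.append[OF zz_eq.comp[OF r(1) t(1)] zz_eq.refl[OF tw]] r(2) by simp
    have 2: "zz_eq C S W Y ([Fwd r] @ ([Fwd t, Inv t] @ w)) ([Fwd r] @ ([] @ w))"
      by (rule zz_eq.append[OF zz_eq.refl[OF rr] zz_eq.append[OF zz_eq.inv_left[OF t(3,1)] zz_eq.refl[OF t(2)]]])
    have 3: "zz_eq C S W Y (Fwd r # w) [Fwd f]"
      by (rule Cons.IH[OF t(2) r(1,3)])
    show ?thesis
      using zz_eq.trans[OF zz_eq.sym[OF 1[simplified]] zz_eq.trans[OF 2[simplified] 3]] Inv by simp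
  qed
qed

end

context percolating_exact_category
begin

interpretation A: serre_class E A A
  by (rule serre_class_A)

text \<open>Forward steps are composed; each backward step is lifted by \<open>right_Ore\<close>,
  which replaces the source by a new one mapping to it by a morphism of Sigma. The start
  \<open>s\<close> is arbitrary so that the induction can continue from any vertex.\<close>

lemma ex_zz_lift:
  "zigzag E (Sigma_perc E A) X w Y \<Longrightarrow> s \<in> Hom E W X \<Longrightarrow>
   \<exists>V u f. admissible_mod E A V W u \<and> zz_lift E w (s \<cdot> u) f"
proof (induction w arbitrary: X W s)
  case Nil
  then show ?case using admissible_mod_Ide[of W] HomD[OF Nil(2)] by auto
next
  case (Cons st w)
  note [simp] = Cons.prems(2)[THEN HomD]
  show ?case
  proof (cases st)
    case (Fwd h)
    then obtain X' where h: "h \<in> Hom E X X'" "zigzag E (Sigma_perc E A) X' w Y"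
      using Cons.prems(1) by (auto simp: Hom_def)
    obtain V u f where u: "admissible_mod E A V W u" "zz_lift E w ((h \<cdot> s) \<cdot> u) f"
      using Cons.IH[OF h(2) Comp_Hom[OF Cons.prems(2) h(1)]] by blast
    note [simp] = h(1)[THEN HomD] A.admissible_mod_Hom[OF u(1), THEN HomD]
    from u Fwd show ?thesis by auto
  next
    case (Inv t)
    then obtain X' where t: "t \<in> Hom E (X') X" "zigzag E (Sigma_perc E A) (X') w Y" "t \<in> Sigma_perc E A"
      using Cons.prems(1) by (auto simp: Hom_def)
    then have "admissible_mod E A (X') X t" using Sigma_perc_iff by blast
    then obtain V1 u1 g where g: "admissible_mod E A V1 W u1" "g \<in> Hom E V1 (X')" "t \<cdot> g = s \<cdot> u1"
      using right_Ore[OF _ Cons.prems(2)] by metis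
    obtain V u f where u: "admissible_mod E A V V1 u" "zz_lift E w (g \<cdot> u) f"
      using Cons.IH[OF t(2) g(2)] by blast
    note [simp] = t(1)[THEN HomD] A.admissible_mod_Hom[OF u(1), THEN HomD]
      A.admissible_mod_Hom[OF g(1), THEN HomD] g(2)[THEN HomD]
    have "zz_lift E (Inv t # w) (s \<cdot> (u1 \<cdot> u)) f"
      using u(2) by (auto intro!: exI[of _ "g \<cdot> u"] simp: g(3)[THEN reassoc] Hom_def)
    then show ?thesis using A.Comp_admissible_mod[OF u(1) g(1)] unfolding Inv by blast
  qed
qed

text \<open>Each generating relation preserves lifts up to precomposition with Sigma. Removing
  \<open>[Fwd t, Inv t]\<close> takes \<open>right_cancel\<close>, since a lift only gives equality
  after \<open>t\<close>; inserting \<open>[Inv t, Fwd t]\<close> takes \<open>right_Ore\<close>.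
  For the other generators an identity serves as \<open>u\<close>. Both directions are treated
  together because symmetry exchanges them.\<close>

lemma zz_lift_zz_eq:
  "zz_eq E (Sigma_perc E A) X Y v w \<Longrightarrow>
    (\<forall>W s f. s \<in> Hom E W X \<longrightarrow> zz_lift E v s f \<longrightarrow>
       (\<exists>V u. admissible_mod E A V W u \<and> zz_lift E w (s \<cdot> u) (f \<cdot> u))) \<and>
    (\<forall>W s f. s \<in> Hom E W X \<longrightarrow> zz_lift E w s f \<longrightarrow>
       (\<exists>V u. admissible_mod E A V W u \<and> zz_lift E v (s \<cdot> u) (f \<cdot> u)))"
  (is "_ \<Longrightarrow> ?P X v w \<and> ?P X w v")
proof (induction rule: zz_eq.induct)
  let ?S = "Sigma_perc E A"
  have same: "\<exists>V u. admissible_mod E A V W u \<and> zz_lift E w (s \<cdot> u) (f \<cdot> u)"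
    if "zigzag E ?S X w Y" "s \<in> Hom E W X" "zz_lift E w s f" for X Y w W s f
    using admissible_mod_Ide[of W] zz_lift_Comp[OF that Ide_Hom] HomD[OF that(2)] by blast
  {
    case refl then show ?case using same by blast
  next
    case (sym X Y v w) then show ?case by blast
  next
    have tr: "?P X u w" if P: "?P X u v" "?P X v w" and z: "zigzag E ?S X u Y" for X Y u v w
    proof (intro allI impI)
      fix W s f assume s: "s \<in> Hom E W X" "zz_lift E u s f"
      then obtain V a where a: "admissible_mod E A V W a" "zz_lift E v (s \<cdot> a) (f \<cdot> a)" using P(1) by blast
      note aH = A.admissible_mod_Hom[OF a(1)]
      obtain V' b where b: "admissible_mod E A V' V b" "zz_lift E w ((s \<cdot> a) \<cdot> b) ((f \<cdot> a) \<cdot> b)"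
        using P(2) a(2) Comp_Hom[OF aH s(1)] by blast
      note bH = A.admissible_mod_Hom[OF b(1)]
      note fH = zz_lift_Hom[OF z s]
      note [simp] = aH[THEN HomD] bH[THEN HomD] fH[THEN HomD] s(1)[THEN HomD]
      from b A.Comp_admissible_mod[OF b(1) a(1)]
      show "\<exists>V u. admissible_mod E A V W u \<and> zz_lift E w (s \<cdot> u) (f \<cdot> u)" by auto
    qed
    case (trans X Y u v w)
    have z: "zigzag E ?S X u Y" "zigzag E ?S X w Y"
      using zz_eq_zigzag[OF category_axioms] trans.hyps by blast+
    show ?case
      by (rule conjI[OF tr[OF conjunct1[OF trans.IH(1)] conjunct1[OF trans.IH(2)] z(1)]
            tr[OF conjunct2[OF trans.IH(2)] conjunct2[OF trans.IH(1)] z(2)]])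
  next
    have ap: "?P X (v @ w) (v' @ w')"
      if P: "?P X v v'" "?P Y w w'"
        and z: "zigzag E ?S X v Y" "zigzag E ?S Y w Z" "zigzag E ?S X v' Y" for X Y Z v w v' w'
    proof (intro allI impI)
      fix W s f assume s: "s \<in> Hom E W X" "zz_lift E (v @ w) s f"
      then obtain g where g: "zz_lift E v s g" "zz_lift E w g f" by (auto simp: zz_lift_append)
      obtain V a where a: "admissible_mod E A V W a" "zz_lift E v' (s \<cdot> a) (g \<cdot> a)" using P(1) g(1) s(1) by blast
      note aH = A.admissible_mod_Hom[OF a(1)]
      note gH = zz_lift_Hom[OF z(1) s(1) g(1)]
      note fH = zz_lift_Hom[OF z(2) gH g(2)]
      have "zz_lift E w (g \<cdot> a) (f \<cdot> a)" by (rule zz_lift_Comp[OF z(2) gH g(2) aH])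
      then obtain V' b where b: "admissible_mod E A V' V b" "zz_lift E w' ((g \<cdot> a) \<cdot> b) ((f \<cdot> a) \<cdot> b)"
        using P(2) Comp_Hom[OF aH gH] by blast
      note bH = A.admissible_mod_Hom[OF b(1)]
      have "zz_lift E v' ((s \<cdot> a) \<cdot> b) ((g \<cdot> a) \<cdot> b)"
        by (rule zz_lift_Comp[OF z(3) Comp_Hom[OF aH s(1)] a(2) bH])
      with b(2) have "zz_lift E (v' @ w') ((s \<cdot> a) \<cdot> b) ((f \<cdot> a) \<cdot> b)"
        by (auto simp: zz_lift_append)
      moreover note [simp] = aH[THEN HomD] bH[THEN HomD] fH[THEN HomD] s(1)[THEN HomD]
      ultimately show "\<exists>V u. admissible_mod E A V W u \<and> zz_lift E (v' @ w') (s \<cdot> u) (f \<cdot> u)"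
        using A.Comp_admissible_mod[OF b(1) a(1)] by auto
    qed
    case (append X Y v v' Z w w')
    have z: "zigzag E ?S X v Y" "zigzag E ?S Y w Z" "zigzag E ?S X v' Y" "zigzag E ?S Y w' Z"
      using zz_eq_zigzag[OF category_axioms] append.hyps by blast+
    show ?case
      by (rule conjI[OF ap[OF conjunct1[OF append.IH(1)] conjunct1[OF append.IH(2)] z(1-3)]
            ap[OF conjunct2[OF append.IH(1)] conjunct2[OF append.IH(2)] z(3,4,1)]])
  next
    case (ide X)
    have eq: "zz_lift E [Fwd (Ide E X)] s f \<longleftrightarrow> zz_lift E [] s f" if "s \<in> Hom E W X" for s f W
      using HomD[OF that] by simp
    have z: "zigzag E ?S X [Fwd (Ide E X)] X" "zigzag E ?S X [] X" using ide by auto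
    show ?case using same[OF z(1)] same[OF z(2)] eq Comp_Hom[OF A.admissible_mod_Hom] by meson
  next
    case (comp f X Y g Z)
    note [simp] = comp[THEN HomD]
    have eq: "zz_lift E [Fwd f, Fwd g] s h \<longleftrightarrow> zz_lift E [Fwd (g \<cdot> f)] s h" if "s \<in> Hom E W X" for s h W
      using HomD[OF that] by simp
    have z: "zigzag E ?S X [Fwd f, Fwd g] Z" "zigzag E ?S X [Fwd (g \<cdot> f)] Z" by auto
    show ?case using same[OF z(1)] same[OF z(2)] eq Comp_Hom[OF A.admissible_mod_Hom] by meson
  next
    case (inv_left t X Y)
    then have t: "admissible_mod E A X Y t" using Sigma_perc_iff by blast
    note [simp] = HomD[OF inv_left(2)]
    have "\<exists>V u. admissible_mod E A V W u \<and> zz_lift E [] (s \<cdot> u) (f \<cdot> u)"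
      if s: "s \<in> Hom E W X" "zz_lift E [Fwd t, Inv t] s f" for s f W
    proof -
      have f: "f \<in> Hom E W X" "t \<cdot> s = t \<cdot> f" using s HomD[OF s(1)] by auto
      show ?thesis using right_cancel[OF t s(1) f] by (metis zz_lift.simps(1))
    qed
    moreover have "\<exists>V u. admissible_mod E A V W u \<and> zz_lift E [Fwd t, Inv t] (s \<cdot> u) (f \<cdot> u)"
      if s: "s \<in> Hom E W X" "zz_lift E [] s f" for s f W
      using that HomD[OF that(1)] same[of X "[Fwd t, Inv t]" X s W f] inv_left by auto
    ultimately show ?case by blast
  next
    case (inv_right t X Y)
    then have t: "admissible_mod E A X Y t" using Sigma_perc_iff by blast
    note [simp] = HomD[OF inv_right(2)]
    have "\<exists>V u. admissible_mod E A V W u \<and> zz_lift E [] (s \<cdot> u) (f \<cdot> u)"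
      if s: "s \<in> Hom E W Y" "zz_lift E [Inv t, Fwd t] s f" for s f W
      using s same[of Y "[]" Y s W s] HomD[OF s(1)] by auto
    moreover have "\<exists>V u. admissible_mod E A V W u \<and> zz_lift E [Inv t, Fwd t] (s \<cdot> u) (f \<cdot> u)"
      if s: "s \<in> Hom E W Y" "zz_lift E [] s f" for s f W
    proof -
      obtain V u g where u: "admissible_mod E A V W u" "g \<in> Hom E V X" "t \<cdot> g = s \<cdot> u"
        using right_Ore[OF t s(1)] by metis
      note [simp] = A.admissible_mod_Hom[OF u(1), THEN HomD] HomD[OF s(1)]
      have "zz_lift E [Inv t, Fwd t] (s \<cdot> u) (f \<cdot> u)" using u s(2) by auto
      with u(1) show ?thesis by blast
    qed
    ultimately show ?case by blast
  }
qed

end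

section \<open>Fractions in the quotient\<close>

context percolating_exact_category
begin

abbreviation quotient ("\<Q>") where "quotient \<equiv> localization E (Sigma_perc E A)"

abbreviation Q where "Q \<equiv> quot_functor E A"

interpretation A: serre_class E A A
  by (rule serre_class_A)

interpretation L: category quotient
  by (rule category_localization) unfold_locales

interpretation Q: cat_functor E quotient "\<lambda>X. X" Q
  unfolding quot_functor_def by (rule functor_loc_map) unfold_locales

lemma zz_class_Fwd: "f \<in> Hom E X Y \<Longrightarrow> zz_class E (Sigma_perc E A) X [Fwd f] Y = Q f"
  by (auto simp: quot_functor_def loc_map_def Hom_def)

text \<open>The zigzag \<open>[Fwd f]\<close> lifts from the identity of \<open>X\<close> to end in
  \<open>f\<close>. Transporting this lift to \<open>[Fwd g]\<close> yields the equation.\<close>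

lemma quot_functor_eqD:
  assumes f: "f \<in> Hom E X Y" and g: "g \<in> Hom E X Y" and eq: "Q f = Q g"
  obtains V u where "admissible_mod E A V X u" "f \<cdot> u = g \<cdot> u"
proof -
  note [simp] = f[THEN HomD] g[THEN HomD]
  have "zz_eq E (Sigma_perc E A) X Y [Fwd f] [Fwd g]"
    using eq zz_class_eq_iff[of E "Sigma_perc E A" X "[Fwd f]" Y "[Fwd g]"] zz_class_Fwd[OF f] zz_class_Fwd[OF g]
    by simp
  from conjunct1[OF zz_lift_zz_eq[OF this]] obtain V u
    where u: "admissible_mod E A V X u" "zz_lift E [Fwd g] (Ide E X \<cdot> u) (f \<cdot> u)"
    using Ide_Hom[of X] by (metis Comp_Ide f zz_lift.simps(1,2) HomD)
  then show thesis using that A.admissible_mod_Hom[OF u(1), THEN HomD] by simp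
qed

lemma quot_functor_fraction:
  assumes "\<phi> \<in> Hom \<Q> X Y"
  obtains V u f where "admissible_mod E A V X u" "f \<in> Hom E V Y" "Q f = \<phi> \<cdot>\<^bsub>\<Q>\<^esub> Q u"
proof -
  obtain w where w: "\<phi> = zz_class E (Sigma_perc E A) X w Y" "zigzag E (Sigma_perc E A) X w Y"
    using assms by (auto simp: localization_Hom)
  then have X: "X \<in> Obj E" using zigzag_Obj[OF category_axioms] by blast
  obtain V u f where u: "admissible_mod E A V X u" "zz_lift E w (Ide E X \<cdot> u) f"
    using ex_zz_lift[OF w(2) Ide_Hom[OF X]] by blast
  note uH = A.admissible_mod_Hom[OF u(1)]
  note [simp] = uH[THEN HomD]
  have l: "zz_lift E w u f" using u(2) by simp
  have f: "f \<in> Hom E V Y" by (rule zz_lift_Hom[OF w(2) uH l])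
  note [simp] = f[THEN HomD]
  have "zz_class E (Sigma_perc E A) V (Fwd u # w) Y = zz_class E (Sigma_perc E A) V [Fwd f] Y"
    using zz_eq_lift[OF w(2) uH l] w(2) by (subst zz_class_eq_iff) auto
  also have "\<dots> = Q f" by (rule zz_class_Fwd[OF f])
  finally have "Q f = \<phi> \<cdot>\<^bsub>\<Q>\<^esub> Q u"
    using localization_Comp[of E "Sigma_perc E A" V "[Fwd u]" X w Y] w zz_class_Fwd[OF uH] by simp
  then show thesis using that[OF u(1) f] by simp
qed

lemma quot_functor_inverts: "admissible_mod E A X Y s \<Longrightarrow> is_iso \<Q> (Q s)"
  unfolding quot_functor_def
  using loc_map_inverts[OF category_axioms] Sigma_perc_iff A.admissible_mod_Hom HomD by metis

text \<open>The witness is the numerator of a fraction for the inverse of \<open>Q f\<close>,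
  refined by \<open>v\<close> so that its composite with \<open>f\<close> is a morphism of Sigma in
  \<open>E\<close> itself. Its image is invertible too, so the lemma can be applied again to the
  witness.\<close>

lemma quot_functor_iso_section:
  assumes f: "f \<in> Hom E X Y" and iso: "is_iso \<Q> (Q f)"
  obtains V g where "g \<in> Hom E V X" "admissible_mod E A V Y (f \<cdot> g)" "is_iso \<Q> (Q g)"
proof -
  note Qf = Q.F_Hom[OF f]
  obtain \<psi> where \<psi>: "\<psi> \<in> Hom \<Q> Y X" "Q f \<cdot>\<^bsub>\<Q>\<^esub> \<psi> = Ide \<Q> Y" "is_iso \<Q> \<psi>"
    using L.is_isoE[OF iso Qf] by metis
  obtain V u g where g: "admissible_mod E A V Y u" "g \<in> Hom E V X" "Q g = \<psi> \<cdot>\<^bsub>\<Q>\<^esub> Q u"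
    using quot_functor_fraction[OF \<psi>(1)] by metis
  note uH = A.admissible_mod_Hom[OF g(1)]
  note Qu = Q.F_Hom[OF uH]
  note [simp] = Qf[THEN L.HomD] \<psi>(1)[THEN L.HomD] Qu[THEN L.HomD] f[THEN HomD] g(2)[THEN HomD] uH[THEN HomD]
  have "Q (f \<cdot> g) = Q f \<cdot>\<^bsub>\<Q>\<^esub> (\<psi> \<cdot>\<^bsub>\<Q>\<^esub> Q u)" using Q.F_Comp[OF g(2) f] g(3) by simp
  also have "\<dots> = Q u" by (simp add: \<psi>(2)[THEN L.reassoc])
  finally obtain V' v where v: "admissible_mod E A V' V v" "(f \<cdot> g) \<cdot> v = u \<cdot> v"
    using quot_functor_eqD[OF Comp_Hom[OF g(2) f] uH] by metis
  note vH = A.admissible_mod_Hom[OF v(1)]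
  note [simp] = vH[THEN HomD]
  have "admissible_mod E A V' Y (f \<cdot> (g \<cdot> v))"
    using A.Comp_admissible_mod[OF v(1) g(1)] v(2) by simp
  moreover have "is_iso \<Q> (Q (g \<cdot> v))"
    using L.is_iso_Comp[OF Qu \<psi>(1) quot_functor_inverts[OF g(1)] \<psi>(3)]
      L.is_iso_Comp[OF Q.F_Hom[OF vH] Q.F_Hom[OF g(2)] quot_functor_inverts[OF v(1)]]
    by (simp add: Q.F_Comp[OF vH g(2)] g(3))
  ultimately show thesis using that[OF Comp_Hom[OF vH g(2)]] by blast
qed

text \<open>With \<open>f \<cdot> g\<close> and \<open>g \<cdot> g'\<close> in \<open>\<Sigma>\<close>, first \<open>g\<close> and then \<open>f\<close> lie in \<open>\<Sigma>\<close>.\<close>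

lemma quot_functor_iso_imp_Sigma:
  assumes f: "f \<in> Hom E X Y" and iso: "is_iso \<Q> (Q f)"
  shows "admissible_mod E A X Y f"
proof -
  obtain V g where g: "g \<in> Hom E V X" "admissible_mod E A V Y (f \<cdot> g)" "is_iso \<Q> (Q g)"
    using quot_functor_iso_section[OF f iso] by metis
  obtain V' g' where g': "g' \<in> Hom E V' V" "admissible_mod E A V' X (g \<cdot> g')"
    using quot_functor_iso_section[OF g(1,3)] by metis
  have "admissible_mod E A V X g"
    by (rule two_out_of_six[OF g(1) f g'(1) g(2) g'(2)])
  then show ?thesis using A.admissible_mod_cancel_right[OF f _ g(2)] by blast
qed

text \<open>By saturation the numerator lies in Sigma too, so the isomorphism is a span with both
  legs in Sigma.\<close>

lemma quot_iso_fraction: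
  assumes "\<phi> \<in> Hom \<Q> X Y" "is_iso \<Q> \<phi>"
  obtains V u f where "admissible_mod E A V X u" "admissible_mod E A V Y f" "Q f = \<phi> \<cdot>\<^bsub>\<Q>\<^esub> Q u"
proof -
  obtain V u f where u: "admissible_mod E A V X u" "f \<in> Hom E V Y" "Q f = \<phi> \<cdot>\<^bsub>\<Q>\<^esub> Q u"
    using quot_functor_fraction[OF assms(1)] by metis
  have "is_iso \<Q> (Q f)"
    using L.is_iso_Comp[OF Q.F_Hom[OF A.admissible_mod_Hom[OF u(1)]] assms(1) quot_functor_inverts[OF u(1)] assms(2)] u(3)
    by simp
  then show thesis using that u quot_functor_iso_imp_Sigma[OF u(2)] by blast
qed


section \<open>Admissible morphisms of the quotient\<close>

interpretation Ob: serre_class E A "Obj E"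
  by (rule serre_class_Obj)

text \<open>The isomorphisms become spans \<open>(s, f)\<close>, \<open>(t, g)\<close> and
  \<open>(t', g')\<close> with legs in Sigma. Two Ore squares carry \<open>p\<close> and
  \<open>i\<close> across them to a morphism \<open>g' \<cdot> h'\<close> of \<open>E\<close>, which
  is admissible by cancelling the denominators \<open>t\<close> and \<open>t'\<close>. After
  precomposition with Sigma it equals \<open>k\<close> composed with a morphism of Sigma, which is
  cancelled on the right.\<close>

lemma quot_functor_reflects_admissible_composite:
  assumes k: "k \<in> Hom E X Z"
    and p: "conflation E n p N Y1 C1" and i: "conflation E i c I Z1 D"
    and \<beta>: "\<beta> \<in> Hom \<Q> Y1 X" "is_iso \<Q> \<beta>" and \<phi>: "\<phi> \<in> Hom \<Q> C1 I" "is_iso \<Q> \<phi>"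
    and \<gamma>: "\<gamma> \<in> Hom \<Q> Z1 Z" "is_iso \<Q> \<gamma>"
    and eq: "Q k \<cdot>\<^bsub>\<Q>\<^esub> \<beta> = \<gamma> \<cdot>\<^bsub>\<Q>\<^esub> (Q i \<cdot>\<^bsub>\<Q>\<^esub> (\<phi> \<cdot>\<^bsub>\<Q>\<^esub> Q p))"
  shows "admissible_mod E (Obj E) X Z k"
proof -
  note pH = conflationD(2)[OF p] and iH = conflationD(1)[OF i]
  have N: "N \<in> Obj E" and D: "D \<in> Obj E"
    using HomD[OF conflationD(1)[OF p]] HomD[OF conflationD(2)[OF i]] by auto
  obtain W s f where s: "admissible_mod E A W Y1 s" "admissible_mod E A W X f" "Q f = \<beta> \<cdot>\<^bsub>\<Q>\<^esub> Q s"
    using quot_iso_fraction[OF \<beta>] by metis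
  obtain T t g where t: "admissible_mod E A T C1 t" "admissible_mod E A T I g" "Q g = \<phi> \<cdot>\<^bsub>\<Q>\<^esub> Q t"
    using quot_iso_fraction[OF \<phi>] by metis
  obtain T' t' g' where t': "admissible_mod E A T' Z1 t'" "admissible_mod E A T' Z g'" "Q g' = \<gamma> \<cdot>\<^bsub>\<Q>\<^esub> Q t'"
    using quot_iso_fraction[OF \<gamma>] by metis
  note H = s(1,2)[THEN A.admissible_mod_Hom] t(1,2)[THEN A.admissible_mod_Hom] t'(1,2)[THEN A.admissible_mod_Hom]
  obtain V r e where e: "admissible_mod E A V W r" "e \<in> Hom E V T" "t \<cdot> e = (p \<cdot> s) \<cdot> r"
    using right_Ore[OF t(1) Comp_Hom[OF H(1) pH]] by metis
  note rH = A.admissible_mod_Hom[OF e(1)]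
  \<comment> \<open>In the quotient, \<open>h\<close> represents the path through \<open>r\<close>,
    \<open>s\<close>, \<open>p\<close>, \<open>\<phi>\<close> and \<open>i\<close>: the morphism
    \<open>e\<close> lifts \<open>p \<cdot> s \<cdot> r\<close> through the denominator
    \<open>t\<close> of \<open>\<phi>\<close>, and \<open>g\<close> is the numerator.\<close>
  define h where "h = i \<cdot> (g \<cdot> e)"
  have hH: "h \<in> Hom E V Z1" unfolding h_def by (intro Comp_Hom[OF _ iH] Comp_Hom[OF e(2) H(4)])
  obtain V2 v h' where v: "admissible_mod E A V2 V v" "h' \<in> Hom E V2 T'" "t' \<cdot> h' = h \<cdot> v"
    using right_Ore[OF t'(1) hH] by metis
  note vH = A.admissible_mod_Hom[OF v(1)]
  note [simp] = k[THEN HomD] pH[THEN HomD] iH[THEN HomD] H[THEN HomD] e(2)[THEN HomD] rH[THEN HomD]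
    hH[THEN HomD] v(2)[THEN HomD] vH[THEN HomD]
  have "admissible_mod E (Obj E) V C1 ((p \<cdot> s) \<cdot> r)"
    by (intro Ob.admissible_mod_Comp[OF _ e(1)] Ob.admissible_mod_Comp[OF _ s(1)]
        Ob.admissible_mod_deflation[OF p N])
  then have "admissible_mod E (Obj E) V T e"
    using Ob.admissible_mod_cancel[OF e(2) t(1)] e(3) by simp
  then have "admissible_mod E (Obj E) V Z1 h"
    unfolding h_def by (intro Ob.inflation_Comp_admissible_mod[OF i D] Ob.Comp_admissible_mod[OF _ t(2)])
  then have "admissible_mod E (Obj E) V2 T' h'"
    using Ob.admissible_mod_cancel[OF v(2) t'(1)] Ob.admissible_mod_Comp[OF _ v(1)] v(3) by metis
  then have g'h': "admissible_mod E (Obj E) V2 Z (g' \<cdot> h')"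
    by (rule Ob.Comp_admissible_mod[OF _ t'(2)])
  note QH = Q.F_Hom[OF k] Q.F_Hom[OF pH] Q.F_Hom[OF iH] Q.F_Hom[OF H(1)] Q.F_Hom[OF H(2)] Q.F_Hom[OF H(3)]
    Q.F_Hom[OF H(4)] Q.F_Hom[OF H(5)] Q.F_Hom[OF H(6)] Q.F_Hom[OF e(2)] Q.F_Hom[OF rH] Q.F_Hom[OF vH]
    Q.F_Hom[OF v(2)] Q.F_Hom[OF hH] \<beta>(1) \<phi>(1) \<gamma>(1)
  note [simp] = QH[THEN L.HomD]
  have QC: "Q (y \<cdot> x) = Q y \<cdot>\<^bsub>\<Q>\<^esub> Q x" if "x \<in> Arr E" "y \<in> Arr E" "Cod E x = Dom E y" for x y
    using Q.F_Comp[of x "Dom E x" "Cod E x" y "Cod E y"] that by (simp add: Hom_def)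
  have e': "Q t \<cdot>\<^bsub>\<Q>\<^esub> Q e = Q p \<cdot>\<^bsub>\<Q>\<^esub> (Q s \<cdot>\<^bsub>\<Q>\<^esub> Q r)"
    using arg_cong[OF e(3), of Q] by (simp add: QC)
  have v': "Q t' \<cdot>\<^bsub>\<Q>\<^esub> Q h' = Q h \<cdot>\<^bsub>\<Q>\<^esub> Q v"
    using arg_cong[OF v(3), of Q] by (simp add: QC)
  have "Q k \<cdot>\<^bsub>\<Q>\<^esub> (Q f \<cdot>\<^bsub>\<Q>\<^esub> Q r) = (Q k \<cdot>\<^bsub>\<Q>\<^esub> \<beta>) \<cdot>\<^bsub>\<Q>\<^esub> (Q s \<cdot>\<^bsub>\<Q>\<^esub> Q r)"
    by (simp add: s(3))
  also have "\<dots> = \<gamma> \<cdot>\<^bsub>\<Q>\<^esub> (Q i \<cdot>\<^bsub>\<Q>\<^esub> (\<phi> \<cdot>\<^bsub>\<Q>\<^esub> (Q p \<cdot>\<^bsub>\<Q>\<^esub> (Q s \<cdot>\<^bsub>\<Q>\<^esub> Q r))))"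
    unfolding eq by simp
  also have "\<dots> = \<gamma> \<cdot>\<^bsub>\<Q>\<^esub> Q h"
    by (simp add: e'[symmetric] h_def QC t(3))
  finally have 1: "Q k \<cdot>\<^bsub>\<Q>\<^esub> (Q f \<cdot>\<^bsub>\<Q>\<^esub> Q r) = \<gamma> \<cdot>\<^bsub>\<Q>\<^esub> Q h" .
  have "Q (k \<cdot> (f \<cdot> (r \<cdot> v))) = (Q k \<cdot>\<^bsub>\<Q>\<^esub> (Q f \<cdot>\<^bsub>\<Q>\<^esub> Q r)) \<cdot>\<^bsub>\<Q>\<^esub> Q v" by (simp add: QC)
  also have "\<dots> = \<gamma> \<cdot>\<^bsub>\<Q>\<^esub> (Q t' \<cdot>\<^bsub>\<Q>\<^esub> Q h')" unfolding 1 v' by simp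
  also have "\<dots> = Q (g' \<cdot> h')" by (simp add: QC t'(3))
  finally obtain V3 x where x: "admissible_mod E A V3 V2 x" "(k \<cdot> (f \<cdot> (r \<cdot> v))) \<cdot> x = (g' \<cdot> h') \<cdot> x"
    using quot_functor_eqD[of "k \<cdot> (f \<cdot> (r \<cdot> v))" V2 Z "g' \<cdot> h'"] by (auto simp: Hom_def)
  note [simp] = A.admissible_mod_Hom[OF x(1), THEN HomD]
  have "admissible_mod E (Obj E) V3 Z ((k \<cdot> (f \<cdot> (r \<cdot> v))) \<cdot> x)"
    unfolding x(2) by (rule Ob.admissible_mod_Comp[OF g'h' x(1)])
  then have "admissible_mod E (Obj E) V3 Z (k \<cdot> (f \<cdot> (r \<cdot> (v \<cdot> x))))" by simp
  moreover have "admissible_mod E A V3 X (f \<cdot> (r \<cdot> (v \<cdot> x)))"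
    by (intro A.Comp_admissible_mod[OF _ s(2)] A.Comp_admissible_mod[OF _ e(1)] A.Comp_admissible_mod[OF x(1) v(1)])
  ultimately show ?thesis using Ob.admissible_mod_cancel_right[OF k] by blast
qed

section \<open>Conflations and admissibility across the localization functor\<close>

lemma Confl_quot_catE:
  assumes "(j, q) \<in> Confl (quot_cat E A)"
  obtains i p X Y Z a b c where "conflation E i p X Y Z"
    "a \<in> Hom \<Q> X (Dom \<Q> j)" "b \<in> Hom \<Q> Y (Cod \<Q> j)" "c \<in> Hom \<Q> Z (Cod \<Q> q)"
    "is_iso \<Q> a" "is_iso \<Q> b" "is_iso \<Q> c" "b \<cdot>\<^bsub>\<Q>\<^esub> Q i = j \<cdot>\<^bsub>\<Q>\<^esub> a" "c \<cdot>\<^bsub>\<Q>\<^esub> Q p = q \<cdot>\<^bsub>\<Q>\<^esub> b"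
    "j \<in> Arr \<Q>" "q \<in> Arr \<Q>" "Cod \<Q> j = Dom \<Q> q"
proof -
  obtain i p where ip: "(i, p) \<in> Confl E" "iso_sequences \<Q> (Q i) (Q p) j q"
    using assms by (auto simp: quot_cat_simps)
  note c = conflationI[OF ip(1)]
  have "Dom \<Q> (Q i) = Dom E i" "Cod \<Q> (Q i) = Cod E i" "Cod \<Q> (Q p) = Cod E p"
    using Q.F_Hom[OF conflationD(1)[OF c]] Q.F_Hom[OF conflationD(2)[OF c]] by (auto simp: Hom_def)
  then show thesis using that[OF c] ip(2) unfolding iso_sequences_def composable_def by metis
qed

lemma Confl_quot_cat_image:
  assumes "conflation E i p X Y Z"
  shows "(Q i, Q p) \<in> Confl (quot_cat E A)"
proof -
  note H = Q.F_Hom[OF conflationD(1)[OF assms]] Q.F_Hom[OF conflationD(2)[OF assms]]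
  note [simp] = H[THEN L.HomD]
  have "Ide \<Q> X \<in> Hom \<Q> (Dom \<Q> (Q i)) (Dom \<Q> (Q i))" "Ide \<Q> Y \<in> Hom \<Q> (Cod \<Q> (Q i)) (Cod \<Q> (Q i))"
    "Ide \<Q> Z \<in> Hom \<Q> (Cod \<Q> (Q p)) (Cod \<Q> (Q p))" "composable \<Q> (Q i) (Q p)"
    "Ide \<Q> Y \<cdot>\<^bsub>\<Q>\<^esub> Q i = Q i \<cdot>\<^bsub>\<Q>\<^esub> Ide \<Q> X" "Ide \<Q> Z \<cdot>\<^bsub>\<Q>\<^esub> Q p = Q p \<cdot>\<^bsub>\<Q>\<^esub> Ide \<Q> Y"
    "is_iso \<Q> (Ide \<Q> X)" "is_iso \<Q> (Ide \<Q> Y)" "is_iso \<Q> (Ide \<Q> Z)"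
    by (auto simp: composable_def intro: L.Ide_Hom L.is_iso_Ide)
  then have "iso_sequences \<Q> (Q i) (Q p) (Q i) (Q p)"
    unfolding iso_sequences_def by blast
  then show ?thesis using conflationD(4)[OF assms] by (auto simp: quot_cat_simps)
qed

lemma admissible_quot_cat_image:
  assumes k: "k \<in> Hom E X Z" and adm: "admissible E k"
  shows "admissible (quot_cat E A) (Q k)"
proof -
  obtain n p N I m c C where F: "conflation E n p N X I" "conflation E m c I Z C" "k = m \<cdot> p"
    using adm admissible_iff[OF k] by (auto elim: admissible_modE)
  note H = conflationD(2)[OF F(1)] conflationD(1)[OF F(2)]
  have "deflation (quot_cat E A) (Q p)" "inflation (quot_cat E A) (Q m)"
    using Confl_quot_cat_image[OF F(1)] Confl_quot_cat_image[OF F(2)]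
    unfolding inflation_def deflation_def by blast+
  moreover have "Cod \<Q> (Q p) = I" "Dom \<Q> (Q m) = I" "Q k = Q m \<cdot>\<^bsub>\<Q>\<^esub> Q p"
    using Q.F_Hom[OF H(1)] Q.F_Hom[OF H(2)] Q.F_Comp[OF H] F(3) by (auto simp: Hom_def)
  ultimately show ?thesis
    unfolding admissible_def admissible_with_image_def quot_cat_simps by blast
qed

text \<open>The conflations of \<open>E\<close> behind \<open>\<pi>\<close> and \<open>\<mu>\<close>
  are unrelated, so the codomain \<open>C1\<close> of \<open>p\<close> and the domain
  \<open>I\<close> of \<open>i\<close> may differ. Both are isomorphic in the quotient to the image
  \<open>J\<close>, and the resulting isomorphism from \<open>C1\<close> to \<open>I\<close> is the
  middle one required by the preceding composite argument.\<close>

lemma admissible_quot_cat_reflect: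
  assumes k: "k \<in> Hom E X Z" and adm: "admissible (quot_cat E A) (Q k)"
  shows "admissible E k"
proof -
  obtain \<pi> \<mu> where "deflation (quot_cat E A) \<pi>" "inflation (quot_cat E A) \<mu>"
    and eq: "Cod \<Q> \<pi> = Dom \<Q> \<mu>" "Q k = \<mu> \<cdot>\<^bsub>\<Q>\<^esub> \<pi>"
    using adm by (auto simp: admissible_def admissible_with_image_def quot_cat_simps)
  then obtain \<nu> \<epsilon> where "(\<nu>, \<pi>) \<in> Confl (quot_cat E A)" "(\<mu>, \<epsilon>) \<in> Confl (quot_cat E A)"
    unfolding inflation_def deflation_def by blast
  obtain n p N Y1 C1 b c where P: "conflation E n p N Y1 C1"
    "b \<in> Hom \<Q> Y1 (Dom \<Q> \<pi>)" "c \<in> Hom \<Q> C1 (Cod \<Q> \<pi>)" "is_iso \<Q> b" "is_iso \<Q> c"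
    "c \<cdot>\<^bsub>\<Q>\<^esub> Q p = \<pi> \<cdot>\<^bsub>\<Q>\<^esub> b" "\<pi> \<in> Arr \<Q>"
    using Confl_quot_catE[OF \<open>(\<nu>, \<pi>) \<in> _\<close>] by metis
  obtain i d I Z1 D a b' where M: "conflation E i d I Z1 D"
    "a \<in> Hom \<Q> I (Dom \<Q> \<mu>)" "b' \<in> Hom \<Q> Z1 (Cod \<Q> \<mu>)" "is_iso \<Q> a" "is_iso \<Q> b'"
    "b' \<cdot>\<^bsub>\<Q>\<^esub> Q i = \<mu> \<cdot>\<^bsub>\<Q>\<^esub> a" "\<mu> \<in> Arr \<Q>"
    using Confl_quot_catE[OF \<open>(\<mu>, \<epsilon>) \<in> _\<close>] by metis
  obtain J where J: "Cod \<Q> \<pi> = J" "Dom \<Q> \<mu> = J" using eq(1) by blast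
  have XZ: "Dom \<Q> \<pi> = X" "Cod \<Q> \<mu> = Z"
    using L.HomD[OF Q.F_Hom[OF k]] P(7) M(7) eq by auto
  note P = P[unfolded XZ J] and M = M[unfolded XZ J]
  obtain a' where a': "a' \<in> Hom \<Q> J I" "a \<cdot>\<^bsub>\<Q>\<^esub> a' = Ide \<Q> J" "is_iso \<Q> a'"
    using L.is_isoE[OF M(4,2)] by metis
  note [simp] = P(2,3)[THEN L.HomD] M(2,3)[THEN L.HomD] a'(1)[THEN L.HomD] P(7) M(7) XZ J
    Q.F_Hom[OF conflationD(2)[OF P(1)], THEN L.HomD] Q.F_Hom[OF conflationD(1)[OF M(1)], THEN L.HomD]
  have "Q k \<cdot>\<^bsub>\<Q>\<^esub> b = \<mu> \<cdot>\<^bsub>\<Q>\<^esub> (c \<cdot>\<^bsub>\<Q>\<^esub> Q p)" by (simp add: eq(2) P(6))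
  also have "\<dots> = (\<mu> \<cdot>\<^bsub>\<Q>\<^esub> a) \<cdot>\<^bsub>\<Q>\<^esub> (a' \<cdot>\<^bsub>\<Q>\<^esub> (c \<cdot>\<^bsub>\<Q>\<^esub> Q p))" by (simp add: a'(2)[THEN L.reassoc])
  also have "\<dots> = b' \<cdot>\<^bsub>\<Q>\<^esub> (Q i \<cdot>\<^bsub>\<Q>\<^esub> ((a' \<cdot>\<^bsub>\<Q>\<^esub> c) \<cdot>\<^bsub>\<Q>\<^esub> Q p))" unfolding M(6)[symmetric] by simp
  finally have "admissible_mod E (Obj E) X Z k"
    by (rule quot_functor_reflects_admissible_composite[OF k P(1) M(1) P(2,4) L.Comp_Hom[OF P(3) a'(1)]
          L.is_iso_Comp[OF P(3) a'(1) P(5) a'(3)] M(3,5)])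
  then show ?thesis using admissible_iff[OF k] by simp
qed

end

theorem theorem2p16:
  fixes E :: "('o, 'm, 'z) exact_cat_scheme" and A :: "'o set"
  assumes "exact_category E"
    and "percolating_subcategory E A"
    and "k \<in> Hom E X Z"
  shows "admissible E k \<longleftrightarrow> admissible (quot_cat E A) (quot_functor E A k)"
proof -
  interpret percolating_exact_category E A
    using assms(1,2) by (rule percolating_exact_category.intro)
  show ?thesis using admissible_quot_cat_image admissible_quot_cat_reflect assms(3) by blast
qed

end
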